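(* Let $n\ge3$, $0\le n_0\le n$ and $\alpha,\alpha_*,\beta,\beta_*\in(0,1]$. The stationary distribution of the two-row $D^*$ process on $\widehat\Omega^*_{n,n_0}$ is given by $$\hat\pi^*(\omega)=\frac{q(\omega)}{Z^*_{n,n_0}},\qquad Z^*_{n,n_0}=\sum_{\omega\in\widehat\Omega^*_{n,n_0}}q(\omega).$$
   Context: Write $\bar1=-1$ and write $(a/b)$ for a column with top entry $a$ and bottom entry $b$. Configurations. $\widehat\Omega^*_{n,n_0}$ is the set of sequences $\omega$ of $n$ columns, each one of $(1/1),(1/\bar1),(\bar1/1),(\bar1/\bar1)$, $(0/0)$ (a $0$-column), $( */* )$ (a $*$-column), such that: there are exactly $n_0$ $0$-columns; columns $1$ and $n$ are $0$- or $*$-columns, and $*$-columns occur nowhere else; (balance) in each maximal run of consecutive columns containing no $0$- or $*$-column, the number of $1$'s (both rows) equals the number of $\bar1$'s; (positivity) for every $j$, columns $1,\dots,j$ contain at least as many $1$'s as $\bar1$'s. The map $T_*(\omega,i)$, $1\le i\le n-1$. Wall $i$ is the line between columns $i$ and $i+1$. For $i\ge2$ let $j_1$ be the smallest $j\in\{1,\dots,i-1\}$ such that columns $j+1,\dots,i-1$ all have top entry $\bar1$. For $i\le n-2$ let $j_2$ be the largest $j\in\{i+1,\dots,n-1\}$ such that columns $i+2,\dots,j$ all have top entry $1$. "Fill position $j_2$" means: if column $j_2+1$ is $(\bar1/b)$, set column $j_2$ to $(1/b)$ and column $j_2+1$ to $(\bar1/\bar1)$; otherwise set column $j_2$ to $(1/\bar1)$.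 - For $2\le i\le n-2$: (B1) if column $i$ is $(1/b)$ or $(0/0)$ and column $i+1$ is $(\bar1/1)$: delete column $i+1$, shift columns $j_1+1,\dots,i$ one step right, and put $(\bar1/1)$ at position $j_1+1$. (B2) if columns $i,i+1$ are $(1/b),(\bar1/\bar1)$, put $(\bar1/b)$ at position $i$; if they are $(1/\bar1),(0/0)$, put $(0/0)$ at position $i$; in both cases then shift columns $i+2,\dots,j_2$ one step left and fill position $j_2$. - For $i=1$: (L1) if columns $1,2$ are $( */* ),(\bar1/1)$: delete column $2$, shift columns $3,\dots,j_2$ one step left, fill position $j_2$. (L2) if they are $( */* ),(0/0)$: set column $1$ to $(0/0)$, shift columns $3,\dots,j_2$ one step left, fill position $j_2$. (L3) if they are $(0/0),(\bar1/1)$: replace them by $( */* ),(0/0)$. - For $i=n-1$: (R1) if columns $n-1,n$ are $(1/\bar1),( */* )$: delete column $n-1$, shift columns $j_1+1,\dots,n-2$ one step right, put $(\bar1/1)$ at position $j_1+1$. (R2) if they are $(0/0),( */* )$: delete column $n$, shift columns $j_1+1,\dots,n-1$ one step right, put $(\bar1/1)$ at position $j_1+1$. (R3) if they are $(1/\bar1),(0/0)$: replace them by $(0/0),( */* )$. - Otherwise $T_*(\omega,i)=\omega$. The two-row $D^*$ process: from $\omega$, choose $i\in\{1,\dots,n-1\}$ uniformly and move to $T_*(\omega,i)$ with probability $\lambda$, staying at $\omega$ otherwise, where $\lambda=1$ for B1, B2, L3, R3, $\lambda=\alpha$ for L1, $\alpha_*$ for L2, $\beta$ for R1, $\beta_*$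 for R2. Weights. A block is a set of consecutive columns $p,\dots,r$ with no $0$- or $*$-column, with column $p$ equal to $(1/1)$, column $r$ equal to $(\bar1/\bar1)$, and such that the columns $p+1,\dots,r-1$ (the inside of the block) contain equally many $1$'s and $\bar1$'s and every initial segment of them contains at least as many $1$'s as $\bar1$'s. Label by $z$ each $\bar1$ in the bottom row that is to the right of the rightmost $0$-column (no condition if $n_0=0$) and not in a block (ends of blocks included). Label by $z'$ each $\bar1$ in the bottom row to the left of the leftmost $0$-column (no condition if $n_0=0$) and not in a block. Label by $y$ each $1$ in the bottom row to the left of the leftmost $0$-column (no condition if $n_0=0$), not in the inside of a block, and with no $z'$-label to its left. Let $n_y,n_z$ be the numbers of $y$- and $z$-labels; $n_{y_*}=1$ if column $1$ is a $*$-column and $0$ otherwise; $n_{z_*}=1$ if column $n$ is a $*$-column and $0$ otherwise. Set $$q(\omega)=\alpha^{-n_y(\omega)}\alpha_*^{-n_{y_*}(\omega)}\beta^{-n_z(\omega)}\beta_*^{-n_{z_*}(\omega)}.$$ *)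

theory Defs
  imports "HOL-Probability.Probability_Mass_Function"
begin

section \<open>Configurations\<close>

text \<open>\<open>Plus\<close> and \<open>Minus\<close> stand for the entries 1 and -1;
  \<open>Spins a b\<close> is the column with top entry \<open>a\<close> and bottom entry \<open>b\<close>.\<close>

datatype spin = Plus | Minus

datatype column = Spins spin spin | Zero | Star

fun is_spins :: "column \<Rightarrow> bool" where
  "is_spins (Spins a b) = True"
| "is_spins Zero = False"
| "is_spins Star = False"

fun entries :: "column \<Rightarrow> spin list" where
  "entries (Spins a b) = [a, b]"
| "entries Zero = []"
| "entries Star = []"

definition has_top :: "spin \<Rightarrow> column \<Rightarrow> bool" where
  "has_top a c \<longleftrightarrow> (\<exists>b. c = Spins a b)"

definition has_bottom :: "spin \<Rightarrow> column \<Rightarrow> bool" where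
  "has_bottom b c \<longleftrightarrow> (\<exists>a. c = Spins a b)"

text \<open>Columns are numbered from 1, whereas list positions are numbered from 0.\<close>

definition col :: "column list \<Rightarrow> nat \<Rightarrow> column" where
  "col \<omega> j = \<omega> ! (j - 1)"

definition put :: "column list \<Rightarrow> nat \<Rightarrow> column \<Rightarrow> column list" where
  "put \<omega> j c = list_update \<omega> (j - 1) c"

definition occurrences :: "spin \<Rightarrow> column list \<Rightarrow> nat \<Rightarrow> nat \<Rightarrow> nat" where
  "occurrences s \<omega> a b = (\<Sum>j\<in>{a..b}. count_list (entries (col \<omega> j)) s)"

definition spin_run :: "column list \<Rightarrow> nat \<Rightarrow> nat \<Rightarrow> bool" where
  "spin_run \<omega> p r \<longleftrightarrow>
     1 \<le> p \<and> p \<le> r \<and> r \<le> length \<omega> \<and> (\<forall>j\<in>{p..r}. is_spins (col \<omega> j))"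

definition maximal_run :: "column list \<Rightarrow> nat \<Rightarrow> nat \<Rightarrow> bool" where
  "maximal_run \<omega> p r \<longleftrightarrow> spin_run \<omega> p r \<and>
     (p = 1 \<or> \<not> is_spins (col \<omega> (p - 1))) \<and>
     (r = length \<omega> \<or> \<not> is_spins (col \<omega> (r + 1)))"

definition configs :: "nat \<Rightarrow> nat \<Rightarrow> column list set" where
  "configs n n\<^sub>0 = {\<omega>. length \<omega> = n \<and>
     card {j \<in> {1..n}. col \<omega> j = Zero} = n\<^sub>0 \<and>
     col \<omega> 1 \<in> {Zero, Star} \<and> col \<omega> n \<in> {Zero, Star} \<and>
     (\<forall>j\<in>{1..n}. col \<omega> j = Star \<longrightarrow> j = 1 \<or> j = n) \<and>
     (\<forall>p r. maximal_run \<omega> p r \<longrightarrow> occurrences Plus \<omega> p r = occurrences Minus \<omega> p r) \<and>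
     (\<forall>j\<in>{1..n}. occurrences Plus \<omega> 1 j \<ge> occurrences Minus \<omega> 1 j)}"


section \<open>The map and the two-row process\<close>

text \<open>Shifting columns \<open>a,\<dots>,b\<close> right overwrites column \<open>b+1\<close> and leaves position \<open>a\<close> to be
  refilled; shifting them left overwrites column \<open>a-1\<close> and leaves position \<open>b\<close> to be refilled.
  Both do nothing if \<open>a > b\<close>.  The overwritten column is the one deleted by the move (or, in
  move \<open>B2\<close>, the one made redundant by the column put at position \<open>i\<close>).\<close>

definition shift_right :: "column list \<Rightarrow> nat \<Rightarrow> nat \<Rightarrow> column list" where
  "shift_right \<omega> a b =
     map (\<lambda>j. if a + 1 \<le> j \<and> j \<le> b + 1 then col \<omega> (j - 1) else col \<omega> j) [1..<length \<omega> + 1]"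

definition shift_left :: "column list \<Rightarrow> nat \<Rightarrow> nat \<Rightarrow> column list" where
  "shift_left \<omega> a b =
     map (\<lambda>j. if a \<le> j + 1 \<and> j + 1 \<le> b then col \<omega> (j + 1) else col \<omega> j) [1..<length \<omega> + 1]"

definition fill :: "column list \<Rightarrow> nat \<Rightarrow> column list" where
  "fill \<omega> j = (case col \<omega> (j + 1) of
       Spins Minus b \<Rightarrow> put (put \<omega> j (Spins Plus b)) (j + 1) (Spins Minus Minus)
     | _ \<Rightarrow> put \<omega> j (Spins Plus Minus))"

text \<open>\<open>left_end\<close> is used for \<open>2 \<le> i\<close> and \<open>right_end\<close> for \<open>i \<le> n - 2\<close>
  only, so the sets below are non-empty.\<close>

definition left_end :: "column list \<Rightarrow> nat \<Rightarrow> nat" where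
  "left_end \<omega> i =
     Min {j \<in> {1..i - 1}. \<forall>k\<in>{j + 1..i - 1}. has_top Minus (col \<omega> k)}"

definition right_end :: "column list \<Rightarrow> nat \<Rightarrow> nat" where
  "right_end \<omega> i =
     Max {j \<in> {i + 1..length \<omega> - 1}. \<forall>k\<in>{i + 2..j}. has_top Plus (col \<omega> k)}"

datatype move = B1 | B2_spin spin | B2_zero | L1 | L2 | L3 | R1 | R2 | R3 | No_move

definition move_at :: "column list \<Rightarrow> nat \<Rightarrow> move" where
  "move_at \<omega> i = (let n = length \<omega> in
     if 2 \<le> i \<and> i \<le> n - 2 then
       (case (col \<omega> i, col \<omega> (i + 1)) of
          (Spins Plus b, Spins Minus Plus) \<Rightarrow> B1
        | (Zero, Spins Minus Plus) \<Rightarrow> B1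
        | (Spins Plus b, Spins Minus Minus) \<Rightarrow> B2_spin b
        | (Spins Plus Minus, Zero) \<Rightarrow> B2_zero
        | _ \<Rightarrow> No_move)
     else if i = 1 then
       (case (col \<omega> 1, col \<omega> 2) of
          (Star, Spins Minus Plus) \<Rightarrow> L1
        | (Star, Zero) \<Rightarrow> L2
        | (Zero, Spins Minus Plus) \<Rightarrow> L3
        | _ \<Rightarrow> No_move)
     else if i = n - 1 then
       (case (col \<omega> (n - 1), col \<omega> n) of
          (Spins Plus Minus, Star) \<Rightarrow> R1
        | (Zero, Star) \<Rightarrow> R2
        | (Spins Plus Minus, Zero) \<Rightarrow> R3
        | _ \<Rightarrow> No_move)
     else No_move)"

definition T_star :: "column list \<Rightarrow> nat \<Rightarrow> column list" where
  "T_star \<omega> i =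
     (let n = length \<omega>; j\<^sub>1 = left_end \<omega> i; j\<^sub>2 = right_end \<omega> i in
      case move_at \<omega> i of
        B1 \<Rightarrow> put (shift_right \<omega> (j\<^sub>1 + 1) i) (j\<^sub>1 + 1) (Spins Minus Plus)
      | B2_spin b \<Rightarrow> fill (shift_left (put \<omega> i (Spins Minus b)) (i + 2) j\<^sub>2) j\<^sub>2
      | B2_zero \<Rightarrow> fill (shift_left (put \<omega> i Zero) (i + 2) j\<^sub>2) j\<^sub>2
      | L1 \<Rightarrow> fill (shift_left \<omega> 3 j\<^sub>2) j\<^sub>2
      | L2 \<Rightarrow> fill (shift_left (put \<omega> 1 Zero) 3 j\<^sub>2) j\<^sub>2
      | L3 \<Rightarrow> put (put \<omega> 1 Star) 2 Zero
      | R1 \<Rightarrow> put (shift_right \<omega> (j\<^sub>1 + 1) (n - 2)) (j\<^sub>1 + 1) (Spins Minus Plus)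
      | R2 \<Rightarrow> put (shift_right \<omega> (j\<^sub>1 + 1) (n - 1)) (j\<^sub>1 + 1) (Spins Minus Plus)
      | R3 \<Rightarrow> put (put \<omega> (n - 1) Zero) n Star
      | No_move \<Rightarrow> \<omega>)"

text \<open>The value for \<open>No_move\<close> is irrelevant, since then \<open>T_star \<omega> i = \<omega>\<close>.\<close>

fun rate :: "real \<Rightarrow> real \<Rightarrow> real \<Rightarrow> real \<Rightarrow> move \<Rightarrow> real" where
  "rate \<alpha> \<alpha>\<^sub>s \<beta> \<beta>\<^sub>s L1 = \<alpha>"
| "rate \<alpha> \<alpha>\<^sub>s \<beta> \<beta>\<^sub>s L2 = \<alpha>\<^sub>s"
| "rate \<alpha> \<alpha>\<^sub>s \<beta> \<beta>\<^sub>s R1 = \<beta>"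
| "rate \<alpha> \<alpha>\<^sub>s \<beta> \<beta>\<^sub>s R2 = \<beta>\<^sub>s"
| "rate \<alpha> \<alpha>\<^sub>s \<beta> \<beta>\<^sub>s _ = 1"

definition two_row_step ::
  "real \<Rightarrow> real \<Rightarrow> real \<Rightarrow> real \<Rightarrow> column list \<Rightarrow> column list pmf" where
  "two_row_step \<alpha> \<alpha>\<^sub>s \<beta> \<beta>\<^sub>s \<omega> =
     bind_pmf (pmf_of_set {1..length \<omega> - 1}) (\<lambda>i.
     bind_pmf (bernoulli_pmf (rate \<alpha> \<alpha>\<^sub>s \<beta> \<beta>\<^sub>s (move_at \<omega> i))) (\<lambda>accept.
     return_pmf (if accept then T_star \<omega> i else \<omega>)))"

definition stationary_distribution :: "'a set \<Rightarrow> ('a \<Rightarrow> 'a pmf) \<Rightarrow> 'a pmf \<Rightarrow> bool" where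
  "stationary_distribution S K p \<longleftrightarrow> set_pmf p \<subseteq> S \<and> bind_pmf p K = p"


section \<open>Weights\<close>

definition is_block :: "column list \<Rightarrow> nat \<Rightarrow> nat \<Rightarrow> bool" where
  "is_block \<omega> p r \<longleftrightarrow> p < r \<and> spin_run \<omega> p r \<and>
     col \<omega> p = Spins Plus Plus \<and> col \<omega> r = Spins Minus Minus \<and>
     occurrences Plus \<omega> (p + 1) (r - 1) = occurrences Minus \<omega> (p + 1) (r - 1) \<and>
     (\<forall>j\<in>{p + 1..r - 1}. occurrences Plus \<omega> (p + 1) j \<ge> occurrences Minus \<omega> (p + 1) j)"

definition in_block :: "column list \<Rightarrow> nat \<Rightarrow> bool" where
  "in_block \<omega> j \<longleftrightarrow>
     (\<exists>p\<in>{1..length \<omega>}. \<exists>r\<in>{1..length \<omega>}. is_block \<omega> p r \<and> p \<le> j \<and> j \<le> r)"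

definition inside_block :: "column list \<Rightarrow> nat \<Rightarrow> bool" where
  "inside_block \<omega> j \<longleftrightarrow>
     (\<exists>p\<in>{1..length \<omega>}. \<exists>r\<in>{1..length \<omega>}. is_block \<omega> p r \<and> p < j \<and> j < r)"

text \<open>Vacuously true if there are no \<open>Zero\<close> columns.\<close>

definition right_of_zeros :: "column list \<Rightarrow> nat \<Rightarrow> bool" where
  "right_of_zeros \<omega> j \<longleftrightarrow> (\<forall>k\<in>{1..length \<omega>}. col \<omega> k = Zero \<longrightarrow> k < j)"

definition left_of_zeros :: "column list \<Rightarrow> nat \<Rightarrow> bool" where
  "left_of_zeros \<omega> j \<longleftrightarrow> (\<forall>k\<in>{1..length \<omega>}. col \<omega> k = Zero \<longrightarrow> j < k)"

definition z_labels :: "column list \<Rightarrow> nat set" where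
  "z_labels \<omega> = {j \<in> {1..length \<omega>}.
     has_bottom Minus (col \<omega> j) \<and> right_of_zeros \<omega> j \<and> \<not> in_block \<omega> j}"

definition z'_labels :: "column list \<Rightarrow> nat set" where
  "z'_labels \<omega> = {j \<in> {1..length \<omega>}.
     has_bottom Minus (col \<omega> j) \<and> left_of_zeros \<omega> j \<and> \<not> in_block \<omega> j}"

definition y_labels :: "column list \<Rightarrow> nat set" where
  "y_labels \<omega> = {j \<in> {1..length \<omega>}.
     has_bottom Plus (col \<omega> j) \<and> left_of_zeros \<omega> j \<and> \<not> inside_block \<omega> j \<and>
     (\<forall>k\<in>z'_labels \<omega>. \<not> k < j)}"

definition n_y_star :: "column list \<Rightarrow> nat" where
  "n_y_star \<omega> = (if col \<omega> 1 = Star then 1 else 0)"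

definition n_z_star :: "column list \<Rightarrow> nat" where
  "n_z_star \<omega> = (if col \<omega> (length \<omega>) = Star then 1 else 0)"

definition weight :: "real \<Rightarrow> real \<Rightarrow> real \<Rightarrow> real \<Rightarrow> column list \<Rightarrow> real" where
  "weight \<alpha> \<alpha>\<^sub>s \<beta> \<beta>\<^sub>s \<omega> =
     inverse \<alpha> ^ card (y_labels \<omega>) * inverse \<alpha>\<^sub>s ^ n_y_star \<omega> *
     inverse \<beta> ^ card (z_labels \<omega>) * inverse \<beta>\<^sub>s ^ n_z_star \<omega>"

definition partition_function ::
  "real \<Rightarrow> real \<Rightarrow> real \<Rightarrow> real \<Rightarrow> nat \<Rightarrow> nat \<Rightarrow> real" where
  "partition_function \<alpha> \<alpha>\<^sub>s \<beta> \<beta>\<^sub>s n n\<^sub>0 = (\<Sum>\<omega>\<in>configs n n\<^sub>0. weight \<alpha> \<alpha>\<^sub>s \<beta> \<beta>\<^sub>s \<omega>)"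

end

theory Submission
  imports Defs
begin

text \<open>
  Why the weights are stationary.  Every move that changes a configuration \<open>\<omega>\<close> at wall \<open>i\<close> ends at
  a second wall \<open>j\<close>: the end \<open>j\<^sub>1\<close> or \<open>j\<^sub>2\<close> of the range of shifted columns, or the same wall for the two
  corner moves.  The assignment of \<open>(T_star \<omega> i, j)\<close> to \<open>(\<omega>, i)\<close> has three properties.

  \<^item> It can be undone (\<open>sweep_inj\<close>): the two columns at wall \<open>j\<close> tell which kind of move was made, and
    reading on from that wall over columns with top entry -1 (to the right) or 1 (to the left) finds
    the place where the move began.
  \<^item> Wall \<open>j\<close> of the new configuration again admits a move.  So the assignment is a permutation of the
    finite set of pairs at which something happens (\<open>landing_bij\<close>).
  \<^item> It preserves the product of rate and weight (\<open>sweep_balance\<close>).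

  Hence the probability flowing into a configuration, summed over the pairs that lead to it, equals the
  flow out of it, summed over its walls; this is stationarity (\<open>weight_invariant\<close>).

  The weights become tractable through the height of a prefix, which is half the excess of 1's over
  -1's.  A configuration is a path of nonnegative height that is at height 0 at all 0- and \<open>*\<close>-columns,
  and a block is a matched pair of an up-step and a down-step.  A column is in a block if and only if
  the height before or after it is positive, and inside a block if and only if both are
  (\<open>in_block_iff\<close>, \<open>inside_block_iff\<close>).  So all labels can be found by scanning the columns once while
  tracking the height (\<open>y_count\<close>, \<open>z_count\<close>).  A move inserts and deletes columns that leave the height
  unchanged, and it merges two columns into one, or splits one into two, without changing their total
  rise; so the effect on the labels is confined to the walls \<open>i\<close> and \<open>j\<close>.

  Uniqueness.  All moves but \<open>R1\<close> and \<open>R2\<close> increase the first moment of the top row, where entries 1 and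
  \<open>*\<close> count 1 and entries -1 count -1 (\<open>sweep_moment\<close>), and there is only one configuration in which no
  such move is possible (\<open>stuck_is_ground\<close>).  So one configuration can be reached from all
  others, and a chain with this property has at most one stationary distribution
  (\<open>stationary_distribution_unique\<close>).
\<close>

section \<open>Stationary distributions of finite chains\<close>

lemma pmf_bind_finite:
  assumes "finite S" "set_pmf p \<subseteq> S"
  shows "pmf (bind_pmf p K) y = (\<Sum>x\<in>S. pmf p x * pmf (K x) y)"
  unfolding pmf_bind by (subst integral_measure_pmf[OF assms(1)]) (use assms(2) in auto)

text \<open>The positive part can only grow under the kernel, pointwise; since the kernel does not create mass,
  the total cannot grow, so there is equality at every point.\<close>

lemma invariant_pos_part:
  fixes g :: "'a \<Rightarrow> real"
  assumes S: "finite S" and K: "\<And>x. x \<in> S \<Longrightarrow> (\<Sum>y\<in>S. k x y) \<le> 1" "\<And>x y. 0 \<le> k x y"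
    and inv: "\<And>y. y \<in> S \<Longrightarrow> g y = (\<Sum>x\<in>S. g x * k x y)"
    and y: "y \<in> S"
  shows "max 0 (g y) = (\<Sum>x\<in>S. max 0 (g x) * k x y)"
proof -
  let ?p = "\<lambda>x. max 0 (g x)"
  have le: "?p y \<le> (\<Sum>x\<in>S. ?p x * k x y)" if "y \<in> S" for y
  proof -
    have "g y \<le> (\<Sum>x\<in>S. ?p x * k x y)"
      unfolding inv[OF that] by (intro sum_mono mult_right_mono K) auto
    moreover have "0 \<le> (\<Sum>x\<in>S. ?p x * k x y)"
      by (intro sum_nonneg mult_nonneg_nonneg K) auto
    ultimately show ?thesis by simp
  qed
  have "(\<Sum>y\<in>S. \<Sum>x\<in>S. ?p x * k x y) = (\<Sum>x\<in>S. ?p x * (\<Sum>y\<in>S. k x y))"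
    by (subst sum.swap) (simp add: sum_distrib_left)
  also have "\<dots> \<le> (\<Sum>x\<in>S. ?p x)"
    by (intro sum_mono mult_left_le K) auto
  finally have "(\<Sum>y\<in>S. (\<Sum>x\<in>S. ?p x * k x y) - ?p y) \<le> 0"
    by (simp add: sum_subtractf)
  moreover have "0 \<le> (\<Sum>y\<in>S. (\<Sum>x\<in>S. ?p x * k x y) - ?p y)"
    by (intro sum_nonneg) (simp add: le del: max.bounded_iff)
  ultimately have "(\<Sum>y\<in>S. (\<Sum>x\<in>S. ?p x * k x y) - ?p y) = 0" by linarith
  hence "\<forall>y\<in>S. (\<Sum>x\<in>S. ?p x * k x y) - ?p y = 0"
    by (subst (asm) sum_nonneg_eq_0_iff[OF S]) (simp_all add: le del: max.bounded_iff)
  thus ?thesis using y by force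
qed

text \<open>Both the positive and the negative part of the difference of two stationary distributions are
  invariant.  Each of them, if nonzero, is positive at \<open>t\<close>, because positivity spreads along transitions
  and \<open>t\<close> is reached from everywhere.  They cannot both be positive at \<open>t\<close>, so one distribution dominates
  the other, and as both have mass 1 they agree.\<close>

lemma stationary_distribution_unique:
  assumes S: "finite S" and t: "t \<in> S"
    and reach: "\<And>x. x \<in> S \<Longrightarrow> (x, t) \<in> {(x, y). x \<in> S \<and> y \<in> S \<and> y \<in> set_pmf (K x)}\<^sup>*"
    and p: "stationary_distribution S K p" and q: "stationary_distribution S K q"
  shows "p = q"
proof -
  let ?R = "{(x, y). x \<in> S \<and> y \<in> S \<and> y \<in> set_pmf (K x)}"
  let ?k = "\<lambda>x y. pmf (K x) y"
  have inv: "pmf r y = (\<Sum>x\<in>S. pmf r x * ?k x y)" if "stationary_distribution S K r" for r y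
    using pmf_bind_finite[OF S, of r K y] that by (simp add: stationary_distribution_def)
  have K: "(\<Sum>y\<in>S. ?k x y) \<le> 1" for x
    by (metis measure_measure_pmf_finite measure_pmf.prob_le_1 S)
  have total: "(\<Sum>x\<in>S. pmf r x) = 1" if "stationary_distribution S K r" for r
    using that S by (simp add: stationary_distribution_def sum_pmf_eq_1)
  have dichotomy: "pmf r x \<le> pmf s x"
    if r: "stationary_distribution S K r" and s: "stationary_distribution S K s"
      and le: "pmf r t \<le> pmf s t" and x: "x \<in> S" for r s x
  proof (rule ccontr)
    let ?g = "\<lambda>x. pmf r x - pmf s x"
    have invg: "?g y = (\<Sum>x\<in>S. ?g x * ?k x y)" for y
      by (simp only: inv[OF r, of y] inv[OF s, of y] left_diff_distrib sum_subtractf)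
    have pos: "?g y > 0" if R: "(z, y) \<in> ?R\<^sup>*" and "?g z > 0" for z y
      using R \<open>?g z > 0\<close>
    proof (induction rule: rtrancl_induct)
      case (step y z)
      hence "y \<in> S" "z \<in> S" "?k y z > 0" "?g y > 0" by (auto simp: set_pmf_iff pmf_positive)
      hence "0 < max 0 (?g y) * ?k y z" by simp
      also have "\<dots> \<le> (\<Sum>x\<in>S. max 0 (?g x) * ?k x z)"
        using \<open>y \<in> S\<close> by (intro member_le_sum S) auto
      also have "\<dots> = max 0 (?g z)"
        by (rule invariant_pos_part[OF S K pmf_nonneg invg \<open>z \<in> S\<close>, symmetric])
      finally show ?case by simp
    qed
    assume "\<not> pmf r x \<le> pmf s x"
    hence "?g t > 0" using pos[OF reach[OF x]] by simp
    thus False using le by simp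
  qed
  have eq: "r = s" if r: "stationary_distribution S K r" and s: "stationary_distribution S K s"
      and le: "pmf r t \<le> pmf s t" for r s
  proof (rule pmf_eqI)
    fix x
    have "\<forall>x\<in>S. pmf s x - pmf r x = 0"
      by (subst sum_nonneg_eq_0_iff[symmetric])
        (use S total[OF r] total[OF s] dichotomy[OF r s le] in \<open>auto simp: sum_subtractf\<close>)
    moreover have "pmf s x = 0 \<and> pmf r x = 0" if "x \<notin> S"
      using that r s by (auto simp: stationary_distribution_def set_pmf_iff)
    ultimately show "pmf r x = pmf s x" by (cases "x \<in> S") auto
  qed
  show ?thesis using eq[OF p q] eq[OF q p] by (cases "pmf p t \<le> pmf q t") auto
qed

lemma pmf_two_row_step:
  assumes "2 \<le> length \<omega>" and "0 < \<alpha>" "\<alpha> \<le> 1" and "0 < \<alpha>\<^sub>s" "\<alpha>\<^sub>s \<le> 1"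
    and "0 < \<beta>" "\<beta> \<le> 1" and "0 < \<beta>\<^sub>s" "\<beta>\<^sub>s \<le> 1"
  shows "pmf (two_row_step \<alpha> \<alpha>\<^sub>s \<beta> \<beta>\<^sub>s \<omega>) \<omega>' =
    (\<Sum>i\<in>{1..length \<omega> - 1}. rate \<alpha> \<alpha>\<^sub>s \<beta> \<beta>\<^sub>s (move_at \<omega> i) * of_bool (T_star \<omega> i = \<omega>')
       + (1 - rate \<alpha> \<alpha>\<^sub>s \<beta> \<beta>\<^sub>s (move_at \<omega> i)) * of_bool (\<omega> = \<omega>')) / real (length \<omega> - 1)"
proof -
  have r: "0 \<le> rate \<alpha> \<alpha>\<^sub>s \<beta> \<beta>\<^sub>s m" "rate \<alpha> \<alpha>\<^sub>s \<beta> \<beta>\<^sub>s m \<le> 1" for m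
    using assms by (cases m; simp)+
  have coin: "pmf (bind_pmf (bernoulli_pmf (rate \<alpha> \<alpha>\<^sub>s \<beta> \<beta>\<^sub>s m)) (\<lambda>accept. return_pmf (if accept then x else y))) z
    = rate \<alpha> \<alpha>\<^sub>s \<beta> \<beta>\<^sub>s m * of_bool (x = z) + (1 - rate \<alpha> \<alpha>\<^sub>s \<beta> \<beta>\<^sub>s m) * of_bool (y = z)" for m and x y z :: "column list"
    unfolding pmf_bind integral_bernoulli_pmf[OF r] by (simp add: indicator_def of_bool_def)
  have "{1..length \<omega> - 1} \<noteq> {}" using assms(1) by auto
  from integral_pmf_of_set[OF this] show ?thesis
    unfolding two_row_step_def pmf_bind[of "pmf_of_set _"] coin by simp
qed

section \<open>Heights and configurations\<close>

abbreviation "pp \<equiv> Spins Plus Plus"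
abbreviation "pm \<equiv> Spins Plus Minus"
abbreviation "mp \<equiv> Spins Minus Plus"
abbreviation "mm \<equiv> Spins Minus Minus"

text \<open>Both rows contribute to the excess of 1's over -1's in a column, so this excess is even; the rise is
  half of it.\<close>

fun rise :: "column \<Rightarrow> int" where
  "rise (Spins Plus Plus) = 1"
| "rise (Spins Minus Minus) = -1"
| "rise _ = 0"

definition height :: "column list \<Rightarrow> int" where
  "height xs = sum_list (map rise xs)"

lemma height_simps [simp]:
  "height [] = 0" "height (c # xs) = rise c + height xs"
  "height (xs @ ys) = height xs + height ys"
  by (simp_all add: height_def)

lemma rise_nonspin [simp]: "\<not> is_spins c \<Longrightarrow> rise c = 0"
  by (cases c) auto

text \<open>The balance and positivity conditions, for a list of columns that is preceded by columns of total
  rise \<open>h\<close>.\<close>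

fun dyck :: "int \<Rightarrow> column list \<Rightarrow> bool" where
  "dyck h [] = True"
| "dyck h (c # xs) \<longleftrightarrow> 0 \<le> h + rise c \<and> (\<not> is_spins c \<longrightarrow> h = 0) \<and> dyck (h + rise c) xs"

lemma dyck_append [simp]: "dyck h (xs @ ys) \<longleftrightarrow> dyck h xs \<and> dyck (h + height xs) ys"
  by (induction xs arbitrary: h) (auto simp: add.assoc)

lemma dyck_nonneg: "dyck h xs \<Longrightarrow> 0 \<le> h \<Longrightarrow> 0 \<le> h + height xs"
  by (induction xs arbitrary: h) (force simp: add.assoc)+

lemma dyck_iff:
  "dyck h xs \<longleftrightarrow> (\<forall>k<length xs. 0 \<le> h + height (take (Suc k) xs) \<and>
     (\<not> is_spins (xs ! k) \<longrightarrow> h + height (take k xs) = 0))"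
  by (induction xs arbitrary: h) (auto simp: All_less_Suc2 add.assoc)

text \<open>The part of the definition of \<open>configs\<close> that does not mention sizes.\<close>

definition admissible :: "column list \<Rightarrow> bool" where
  "admissible \<omega> \<longleftrightarrow> \<omega> \<noteq> [] \<and> hd \<omega> \<in> {Zero, Star} \<and> last \<omega> \<in> {Zero, Star} \<and>
     Star \<notin> set (butlast (tl \<omega>)) \<and> dyck 0 \<omega>"

lemma height_take_Suc:
  assumes "1 \<le> j" "j \<le> length \<omega>"
  shows "height (take j \<omega>) = height (take (j - 1) \<omega>) + rise (col \<omega> j)"
  using assms by (cases j) (auto simp: take_Suc_conv_app_nth col_def)

lemma occurrences_height:
  assumes "1 \<le> a" "b \<le> length \<omega>" "a \<le> Suc b"
  shows "int (occurrences Plus \<omega> a b) - int (occurrences Minus \<omega> a b)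
    = 2 * (height (take b \<omega>) - height (take (a - 1) \<omega>))"
  using assms(2,3)
proof (induction b)
  case 0
  then show ?case using assms(1) by (simp add: occurrences_def)
next
  case (Suc b)
  have *: "int (count_list (entries c) Plus) - int (count_list (entries c) Minus) = 2 * rise c" for c
    by (cases c rule: rise.cases) auto
  show ?case
  proof (cases "a = Suc (Suc b)")
    case True thus ?thesis by (simp add: occurrences_def)
  next
    case False
    hence "{a..Suc b} = insert (Suc b) {a..b}" using Suc.prems by auto
    hence "occurrences s \<omega> a (Suc b) = count_list (entries (col \<omega> (Suc b))) s + occurrences s \<omega> a b" for s
      by (simp add: occurrences_def)
    thus ?thesis
      using Suc.IH Suc.prems False *[of "col \<omega> (Suc b)"] height_take_Suc[of "Suc b" \<omega>]
      by (simp add: algebra_simps)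
  qed
qed

text \<open>A maximal run lies between two non-spin columns, as the first and the last column are such.  Hence all
  runs are balanced if and only if the height does not change from one non-spin column to the next, and it
  is 0 at the first of them.\<close>

lemma balanced_runs_iff:
  assumes "\<omega> \<noteq> []" "\<not> is_spins (col \<omega> 1)" "\<not> is_spins (col \<omega> (length \<omega>))"
  shows "(\<forall>p r. maximal_run \<omega> p r \<longrightarrow> occurrences Plus \<omega> p r = occurrences Minus \<omega> p r) \<longleftrightarrow>
    (\<forall>j\<in>{1..length \<omega>}. \<not> is_spins (col \<omega> j) \<longrightarrow> height (take (j - 1) \<omega>) = 0)" (is "?L \<longleftrightarrow> ?R")
proof
  assume L: ?L
  have "\<not> is_spins (col \<omega> j) \<longrightarrow> height (take (j - 1) \<omega>) = 0" if "1 \<le> j" "j \<le> length \<omega>" for j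
    using that
  proof (induction j rule: less_induct)
    case (less j)
    show ?case
    proof
      assume ns: "\<not> is_spins (col \<omega> j)"
      show "height (take (j - 1) \<omega>) = 0"
      proof (cases "j = 1")
        case False
        define K where "K = {k. 1 \<le> k \<and> k < j \<and> \<not> is_spins (col \<omega> k)}"
        have "finite K" "1 \<in> K" using False less.prems assms by (auto simp: K_def)
        define k where "k = Max K"
        have kK: "k \<in> K" unfolding k_def using \<open>finite K\<close> \<open>1 \<in> K\<close> Max_in by blast
        have kmax: "is_spins (col \<omega> l)" if "k < l" "l < j" for l
        proof (rule ccontr)
          assume "\<not> ?thesis"
          hence "l \<in> K" using that by (auto simp: K_def)
          thus False using Max_ge[OF \<open>finite K\<close>] that(1) k_def by fastforce
        qed
        have k: "1 \<le> k" "k < j" "\<not> is_spins (col \<omega> k)" using kK by (auto simp: K_def)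
        hence "height (take (k - 1) \<omega>) = 0" using less by auto
        hence hk: "height (take k \<omega>) = 0" using height_take_Suc[of k \<omega>] k less.prems by simp
        show ?thesis
        proof (cases "k + 1 = j")
          case True thus ?thesis using hk by auto
        next
          case False
          have "maximal_run \<omega> (k + 1) (j - 1)"
            using False k kmax ns less.prems by (auto simp: maximal_run_def spin_run_def)
          hence "occurrences Plus \<omega> (k + 1) (j - 1) = occurrences Minus \<omega> (k + 1) (j - 1)" using L by blast
          thus ?thesis using occurrences_height[of "k + 1" "j - 1" \<omega>] k less.prems hk by simp
        qed
      qed simp
    qed
  qed
  thus ?R by auto
next
  assume R: ?R
  show ?L
  proof (intro allI impI)
    fix p r assume m: "maximal_run \<omega> p r"
    hence pr: "1 \<le> p" "p \<le> r" "r \<le> length \<omega>" "is_spins (col \<omega> p)" "is_spins (col \<omega> r)"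
      by (auto simp: maximal_run_def spin_run_def)
    hence "p \<noteq> 1" "r \<noteq> length \<omega>" using assms by auto
    hence ns: "\<not> is_spins (col \<omega> (p - 1))" "\<not> is_spins (col \<omega> (r + 1))"
      using m by (auto simp: maximal_run_def)
    have "height (take (p - 1 - 1) \<omega>) = 0" "height (take (r + 1 - 1) \<omega>) = 0"
      by (rule R[rule_format]; use ns pr \<open>p \<noteq> 1\<close> \<open>r \<noteq> length \<omega>\<close> in auto)+
    moreover have "height (take (p - 1) \<omega>) = height (take (p - 1 - 1) \<omega>)"
      using height_take_Suc[of "p - 1" \<omega>] ns pr \<open>p \<noteq> 1\<close> by simp
    ultimately show "occurrences Plus \<omega> p r = occurrences Minus \<omega> p r"
      using occurrences_height[of p r \<omega>] pr by simp
  qed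
qed

lemma card_col_eq_count: "card {j \<in> {1..length \<omega>}. col \<omega> j = c} = count_list \<omega> c"
proof -
  have "{j \<in> {1..length \<omega>}. col \<omega> j = c} = Suc ` {i. i < length \<omega> \<and> c = \<omega> ! i}"
  proof (intro set_eqI iffI)
    fix j assume "j \<in> {j \<in> {1..length \<omega>}. col \<omega> j = c}"
    thus "j \<in> Suc ` {i. i < length \<omega> \<and> c = \<omega> ! i}" by (intro image_eqI[of _ _ "j - 1"]) (auto simp: col_def)
  qed (auto simp: col_def)
  thus ?thesis
    by (simp add: card_image count_list_eq_length_filter length_filter_conv_card)
qed

lemma configs_iff:
  assumes "2 \<le> n"
  shows "\<omega> \<in> configs n n\<^sub>0 \<longleftrightarrow> length \<omega> = n \<and> count_list \<omega> Zero = n\<^sub>0 \<and> admissible \<omega>"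
proof (cases "length \<omega> = n")
  case True
  hence ne: "\<omega> \<noteq> []" using assms by auto
  have hl: "col \<omega> 1 = hd \<omega>" "col \<omega> n = last \<omega>"
    using True ne by (auto simp: col_def hd_conv_nth last_conv_nth)
  have mid: "set (butlast (tl \<omega>)) = {col \<omega> j | j. 1 < j \<and> j < n}"
  proof (intro set_eqI iffI)
    fix x assume "x \<in> set (butlast (tl \<omega>))"
    then obtain k where "k < n - 2" "x = butlast (tl \<omega>) ! k" using True by (auto simp: in_set_conv_nth numeral_2_eq_2)
    thus "x \<in> {col \<omega> j | j. 1 < j \<and> j < n}"
      using True by (auto simp: nth_butlast nth_tl col_def intro!: exI[of _ "k + 2"])
  next
    fix x assume "x \<in> {col \<omega> j | j. 1 < j \<and> j < n}"
    then obtain j where j: "1 < j" "j < n" "x = col \<omega> j" by auto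
    hence "x = butlast (tl \<omega>) ! (j - 2)" "j - 2 < length (butlast (tl \<omega>))"
      using True by (auto simp: nth_butlast nth_tl col_def Suc_diff_Suc numeral_2_eq_2)
    thus "x \<in> set (butlast (tl \<omega>))" by simp
  qed
  hence star: "(\<forall>j\<in>{1..n}. col \<omega> j = Star \<longrightarrow> j = 1 \<or> j = n) \<longleftrightarrow> Star \<notin> set (butlast (tl \<omega>))"
  proof -
    have "(\<forall>j\<in>{1..n}. P j \<longrightarrow> j = 1 \<or> j = n) \<longleftrightarrow> (\<forall>j. 1 < j \<and> j < n \<longrightarrow> \<not> P j)" for P
    proof (intro iffI allI ballI impI)
      fix j assume "\<forall>j\<in>{1..n}. P j \<longrightarrow> j = 1 \<or> j = n" "1 < j \<and> j < n"
      thus "\<not> P j" by (metis atLeastAtMost_iff less_imp_le less_irrefl)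
    next
      fix j assume "\<forall>j. 1 < j \<and> j < n \<longrightarrow> \<not> P j" "j \<in> {1..n}" "P j"
      hence "\<not> (1 < j \<and> j < n)" by blast
      thus "j = 1 \<or> j = n" using \<open>j \<in> {1..n}\<close> by auto
    qed
    from this[of "\<lambda>j. col \<omega> j = Star"] show ?thesis unfolding mid mem_Collect_eq by metis
  qed
  have nonspin: "c \<in> {Zero, Star} \<longleftrightarrow> \<not> is_spins c" for c by (cases c) auto
  have pos: "occurrences Minus \<omega> 1 j \<le> occurrences Plus \<omega> 1 j \<longleftrightarrow> 0 \<le> height (take j \<omega>)"
    if "j \<in> {1..n}" for j
    using occurrences_height[of 1 j \<omega>] that True by auto
  have shift: "(\<forall>k<n. P (Suc k)) \<longleftrightarrow> (\<forall>j\<in>{1..n}. P j)" for P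
    by (metis Suc_le_eq atLeastAtMost_iff le_add1 not0_implies_Suc not_one_le_zero plus_1_eq_Suc)
  have "dyck 0 \<omega> \<longleftrightarrow> (\<forall>j\<in>{1..n}. 0 \<le> height (take j \<omega>)) \<and>
      (\<forall>j\<in>{1..n}. \<not> is_spins (col \<omega> j) \<longrightarrow> height (take (j - 1) \<omega>) = 0)"
    unfolding dyck_iff ball_conj_distrib[symmetric] shift[symmetric] using True by (auto simp: col_def)
  moreover have "(\<forall>p r. maximal_run \<omega> p r \<longrightarrow> occurrences Plus \<omega> p r = occurrences Minus \<omega> p r) \<longleftrightarrow>
      (\<forall>j\<in>{1..n}. \<not> is_spins (col \<omega> j) \<longrightarrow> height (take (j - 1) \<omega>) = 0)"
    if "hd \<omega> \<in> {Zero, Star}" "last \<omega> \<in> {Zero, Star}"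
    using balanced_runs_iff[OF ne] that unfolding nonspin hl True by simp
  moreover have "card {j \<in> {1..n}. col \<omega> j = Zero} = count_list \<omega> Zero"
    using card_col_eq_count[of \<omega> Zero] True by simp
  moreover have "(\<forall>j\<in>{1..n}. occurrences Minus \<omega> 1 j \<le> occurrences Plus \<omega> 1 j) \<longleftrightarrow>
      (\<forall>j\<in>{1..n}. 0 \<le> height (take j \<omega>))"
    using pos by blast
  ultimately show ?thesis
    unfolding configs_def admissible_def mem_Collect_eq star hl using True ne by argo
qed (simp add: configs_def)

section \<open>Labels and heights\<close>

text \<open>The number of \<open>y\<close>-labels found by scanning from height \<open>h\<close>.  The scan ends at the first 0-column or
  \<open>z'\<close>-label, which is a column \<open>pm\<close> at height 0.  A 1 in the bottom row is not inside a block exactly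
  when the height before it is 0: it is the beginning of an outermost block or a column \<open>mp\<close> at height 0.\<close>

fun y_count :: "int \<Rightarrow> column list \<Rightarrow> nat" where
  "y_count h [] = 0"
| "y_count h (c # xs) = (if c = Zero \<or> c = pm \<and> h = 0 then 0
     else of_bool (has_bottom Plus c \<and> h = 0) + y_count (h + rise c) xs)"

text \<open>Whether the scan for \<open>y\<close>-labels continues beyond the given columns.\<close>

fun y_open :: "int \<Rightarrow> column list \<Rightarrow> bool" where
  "y_open h [] = True"
| "y_open h (c # xs) \<longleftrightarrow> \<not> (c = Zero \<or> c = pm \<and> h = 0) \<and> y_open (h + rise c) xs"

text \<open>The number of \<open>z\<close>-labels: outside blocks a -1 in the bottom row is in a column \<open>pm\<close> at height 0.\<close>

fun z_count :: "int \<Rightarrow> column list \<Rightarrow> nat" where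
  "z_count h [] = 0"
| "z_count h (c # xs) = of_bool (c = pm \<and> h = 0 \<and> Zero \<notin> set xs) + z_count (h + rise c) xs"

lemma y_count_append:
  "y_count h (xs @ ys) = y_count h xs + (if y_open h xs then y_count (h + height xs) ys else 0)"
  by (induction xs arbitrary: h) (auto simp: add.assoc)

lemma z_count_append:
  "z_count h (xs @ ys) = (if Zero \<in> set ys then 0 else z_count h xs) + z_count (h + height xs) ys"
  by (induction xs arbitrary: h) (auto simp: add.assoc)

lemma card_less_Suc_shift:
  "card {k. k < Suc n \<and> P k} = of_bool (P 0) + card {k. k < n \<and> P (Suc k)}"
proof -
  have "{k. k < Suc n \<and> P k} = (if P 0 then {0} else {}) \<union> Suc ` {k. k < n \<and> P (Suc k)}"
    by (auto simp: image_iff) (metis less_Suc_eq_0_disj)+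
  thus ?thesis by (simp add: card_image)
qed

lemma All_le_Suc_shift: "(\<forall>l\<le>Suc k. P l) \<longleftrightarrow> P 0 \<and> (\<forall>l\<le>k. P (Suc l))"
  by (metis Suc_le_mono le0 not0_implies_Suc)

lemma y_count_eq_card:
  "y_count h xs = card {k. k < length xs \<and> has_bottom Plus (xs ! k) \<and> h + height (take k xs) = 0 \<and>
     (\<forall>l\<le>k. xs ! l \<noteq> Zero) \<and> (\<forall>l<k. \<not> (xs ! l = pm \<and> h + height (take l xs) = 0))}"
proof (induction xs arbitrary: h)
  case (Cons c xs)
  show ?case
  proof (cases "c = Zero \<or> c = pm \<and> h = 0")
    case True
    hence "card {k. k < length (c # xs) \<and> has_bottom Plus ((c # xs) ! k) \<and> h + height (take k (c # xs)) = 0 \<and>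
     (\<forall>l\<le>k. (c # xs) ! l \<noteq> Zero) \<and> (\<forall>l<k. \<not> ((c # xs) ! l = pm \<and> h + height (take l (c # xs)) = 0))} = 0"
      unfolding list.size(4) One_nat_def add_Suc_right add_0_right card_less_Suc_shift
      by (auto simp: has_bottom_def All_less_Suc2 All_le_Suc_shift)
    thus ?thesis using True by auto
  next
    case False
    thus ?thesis
      unfolding list.size(4) One_nat_def add_Suc_right add_0_right card_less_Suc_shift
      by (auto simp: All_less_Suc2 All_le_Suc_shift Cons.IH add.assoc)
  qed
qed simp

lemma z_count_eq_card:
  "z_count h xs = card {k. k < length xs \<and> xs ! k = pm \<and> h + height (take k xs) = 0 \<and>
     (\<forall>l<length xs. xs ! l = Zero \<longrightarrow> l < k)}"
proof (induction xs arbitrary: h)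
  case (Cons c xs)
  have "(\<forall>l<length xs. xs ! l \<noteq> Zero) \<longleftrightarrow> Zero \<notin> set xs" by (auto simp: set_conv_nth)
  thus ?case
    unfolding list.size(4) One_nat_def add_Suc_right add_0_right card_less_Suc_shift
    by (auto simp: All_less_Suc2 Cons.IH add.assoc)
qed simp

lemma all_columns_shift: "(\<forall>j\<in>{1..n}. P j) \<longleftrightarrow> (\<forall>k<n. P (Suc k))"
  by (metis Suc_le_eq atLeastAtMost_iff le_add1 not0_implies_Suc not_one_le_zero plus_1_eq_Suc)

lemma card_columns_shift: "card {j \<in> {1..n}. P j} = card {k. k < n \<and> P (Suc k)}"
proof -
  have "{j \<in> {1..n}. P j} = Suc ` {k. k < n \<and> P (Suc k)}"
    by (auto simp: image_iff) (metis Suc_le_D Suc_le_lessD One_nat_def)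
  thus ?thesis by (simp add: card_image)
qed

context
  fixes \<omega> :: "column list"
  assumes adm: "admissible \<omega>"
begin

lemma take_height_nonneg: "j \<le> length \<omega> \<Longrightarrow> 0 \<le> height (take j \<omega>)"
  using adm dyck_nonneg[of 0 "take j \<omega>"] dyck_append[of 0 "take j \<omega>" "drop j \<omega>"]
  by (simp add: admissible_def)

lemma nonspin_height:
  assumes "1 \<le> j" "j \<le> length \<omega>" "\<not> is_spins (col \<omega> j)"
  shows "height (take (j - 1) \<omega>) = 0" "height (take j \<omega>) = 0"
proof -
  show "height (take (j - 1) \<omega>) = 0"
    using adm assms unfolding admissible_def dyck_iff by (auto simp: col_def)
  thus "height (take j \<omega>) = 0" using assms height_take_Suc[of j \<omega>] by simp
qed

text \<open>The block is the excursion above height 0 around column \<open>j\<close>: \<open>p\<close> is the last position up to \<open>j\<close> that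
  starts at height 0, and \<open>r\<close> the first from \<open>j\<close> on that ends at height 0.\<close>

lemma outer_block:
  assumes j: "1 \<le> j" "j \<le> length \<omega>"
    and pos: "0 < height (take (j - 1) \<omega>) \<or> 0 < height (take j \<omega>)"
  obtains p r where "is_block \<omega> p r" "p \<le> j" "j \<le> r" "1 \<le> p" "r \<le> length \<omega>"
    "height (take (p - 1) \<omega>) = 0" "height (take r \<omega>) = 0"
proof -
  let ?H = "\<lambda>j. height (take j \<omega>)" and ?n = "length \<omega>"
  have "\<omega> \<noteq> []" using adm by (simp add: admissible_def)
  moreover from this have "\<not> is_spins (col \<omega> ?n)"
    using adm by (auto simp: admissible_def col_def last_conv_nth)
  ultimately have "?H ?n = 0" using nonspin_height(2)[of ?n] by (simp add: Suc_le_eq)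
  define Ps where "Ps = {p. 1 \<le> p \<and> p \<le> j \<and> ?H (p - 1) = 0}"
  define Rs where "Rs = {r. j \<le> r \<and> r \<le> ?n \<and> ?H r = 0}"
  have fin: "finite Ps" "finite Rs" by (simp_all add: Ps_def Rs_def)
  have ne: "1 \<in> Ps" "?n \<in> Rs" using j \<open>?H ?n = 0\<close> by (auto simp: Ps_def Rs_def)
  define p where "p = Max Ps"
  define r where "r = Min Rs"
  have "p \<in> Ps" "r \<in> Rs" unfolding p_def r_def using fin ne by (blast intro: Max_in Min_in)+
  hence p: "1 \<le> p" "p \<le> j" "?H (p - 1) = 0" and r: "j \<le> r" "r \<le> ?n" "?H r = 0"
    by (auto simp: Ps_def Rs_def)
  have above: "0 < ?H k" if "p \<le> k" "k < r" for k
  proof (rule ccontr)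
    assume "\<not> ?thesis"
    hence "?H k = 0" using take_height_nonneg[of k] that r by simp
    show False
    proof (cases "k < j")
      case True
      hence "k + 1 \<in> Ps" using \<open>?H k = 0\<close> by (auto simp: Ps_def)
      thus False using Max_ge[OF fin(1)] that p_def by fastforce
    next
      case False
      hence "k \<in> Rs" using \<open>?H k = 0\<close> that r by (auto simp: Rs_def)
      thus False using Min_le[OF fin(2)] that r_def by fastforce
    qed
  qed
  have "p < r"
  proof (rule ccontr)
    assume "\<not> p < r"
    hence "p = j" "r = j" using p r by auto
    thus False using pos p r by auto
  qed
  have rise: "0 < rise c \<Longrightarrow> c = pp" "rise c < 0 \<Longrightarrow> c = mm" for c by (cases c rule: rise.cases; simp)+
  have cp: "col \<omega> p = pp"
    using above[of p] height_take_Suc[of p \<omega>] p r \<open>p < r\<close> by (intro rise) auto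
  have cr: "col \<omega> r = mm"
    using above[of "r - 1"] height_take_Suc[of r \<omega>] p r \<open>p < r\<close> by (intro rise) linarith
  have Hp: "?H p = 1" using height_take_Suc[of p \<omega>] p r \<open>p < r\<close> cp by auto
  have Hr: "?H (r - 1) = 1" using height_take_Suc[of r \<omega>] p r \<open>p < r\<close> cr by auto
  have spins: "is_spins (col \<omega> k)" if "p \<le> k" "k \<le> r" for k
  proof (rule ccontr)
    assume "\<not> ?thesis"
    hence "?H (k - 1) = 0" "?H k = 0" using nonspin_height[of k] that p r by auto
    moreover have "p \<le> k - 1" "k - 1 < r" if "k \<noteq> p" using that \<open>p \<le> k\<close> \<open>k \<le> r\<close> \<open>p < r\<close> by linarith+
    ultimately show False using above[of "k - 1"] Hp by (cases "k = p") auto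
  qed
  have "is_block \<omega> p r"
    unfolding is_block_def spin_run_def
  proof (intro conjI ballI)
    show "occurrences Plus \<omega> (p + 1) (r - 1) = occurrences Minus \<omega> (p + 1) (r - 1)"
      using occurrences_height[of "p + 1" "r - 1" \<omega>] Hp Hr \<open>p < r\<close> r by auto
    fix j assume "j \<in> {p + 1..r - 1}"
    hence "p + 1 \<le> j" "j < r" "j \<le> ?n" using r(2) by auto
    thus "occurrences Minus \<omega> (p + 1) j \<le> occurrences Plus \<omega> (p + 1) j"
      using occurrences_height[of "p + 1" j \<omega>] Hp above[of j] by auto
  qed (use p r \<open>p < r\<close> cp cr spins in auto)
  thus thesis using that p r by blast
qed

text \<open>The left end of a block rises from height at least 0, and by the condition on its inside the path does
  not return below that level before the right end.\<close>

lemma block_height: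
  assumes "is_block \<omega> p r" "p \<le> k" "k < r"
  shows "0 < height (take k \<omega>)"
proof -
  have pr: "1 \<le> p" "p < r" "r \<le> length \<omega>" "col \<omega> p = pp"
    using assms(1) by (auto simp: is_block_def spin_run_def)
  have "0 < height (take p \<omega>)"
    using height_take_Suc[of p \<omega>] take_height_nonneg[of "p - 1"] pr by simp
  moreover have "height (take p \<omega>) \<le> height (take k \<omega>)"
  proof (cases "k = p")
    case False
    hence "k \<in> {p + 1..r - 1}" using assms by auto
    hence "occurrences Minus \<omega> (p + 1) k \<le> occurrences Plus \<omega> (p + 1) k"
      using assms(1) by (auto simp: is_block_def)
    thus ?thesis using occurrences_height[of "p + 1" k \<omega>] assms pr by auto
  qed simp
  ultimately show ?thesis by simp
qed

lemma in_block_iff: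
  assumes "1 \<le> j" "j \<le> length \<omega>"
  shows "in_block \<omega> j \<longleftrightarrow> 0 < height (take (j - 1) \<omega>) \<or> 0 < height (take j \<omega>)"
proof
  assume "in_block \<omega> j"
  then obtain p r where pr: "is_block \<omega> p r" "p \<le> j" "j \<le> r" by (auto simp: in_block_def)
  show "0 < height (take (j - 1) \<omega>) \<or> 0 < height (take j \<omega>)"
  proof (cases "j < r")
    case True thus ?thesis using block_height[OF pr(1,2)] by simp
  next
    case False
    moreover have "p < r" using pr by (simp add: is_block_def)
    ultimately show ?thesis using block_height[OF pr(1), of "j - 1"] pr by auto
  qed
next
  assume "0 < height (take (j - 1) \<omega>) \<or> 0 < height (take j \<omega>)"
  from outer_block[OF assms this] obtain p r
    where "is_block \<omega> p r" "p \<le> j" "j \<le> r" "1 \<le> p" "r \<le> length \<omega>" by metis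
  thus "in_block \<omega> j" unfolding in_block_def by (intro bexI[of _ p] bexI[of _ r]) auto
qed

lemma inside_block_iff:
  assumes "1 \<le> j" "j \<le> length \<omega>"
  shows "inside_block \<omega> j \<longleftrightarrow> 0 < height (take (j - 1) \<omega>) \<and> 0 < height (take j \<omega>)"
proof
  assume "inside_block \<omega> j"
  then obtain p r where pr: "is_block \<omega> p r" "p < j" "j < r" by (auto simp: inside_block_def)
  show "0 < height (take (j - 1) \<omega>) \<and> 0 < height (take j \<omega>)"
    using block_height[OF pr(1), of j] block_height[OF pr(1), of "j - 1"] pr by auto
next
  assume pos: "0 < height (take (j - 1) \<omega>) \<and> 0 < height (take j \<omega>)"
  then obtain p r where pr: "is_block \<omega> p r" "p \<le> j" "j \<le> r" "1 \<le> p" "r \<le> length \<omega>"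
    "height (take (p - 1) \<omega>) = 0" "height (take r \<omega>) = 0"
    using outer_block[OF assms] by metis
  hence "p \<noteq> j" "r \<noteq> j" using pos by auto
  thus "inside_block \<omega> j" unfolding inside_block_def
    using pr by (intro bexI[of _ p] bexI[of _ r]) auto
qed

text \<open>Outside blocks the height is 0 before and after the column, so the column has rise 0.\<close>

lemma bottom_minus_outside_blocks:
  assumes "1 \<le> j" "j \<le> length \<omega>"
  shows "has_bottom Minus (col \<omega> j) \<and> \<not> in_block \<omega> j \<longleftrightarrow> col \<omega> j = pm \<and> height (take (j - 1) \<omega>) = 0"
  unfolding in_block_iff[OF assms]
  using take_height_nonneg[of j] take_height_nonneg[of "j - 1"] height_take_Suc[of j \<omega>] assms
  by (cases "col \<omega> j" rule: rise.cases) (auto simp: has_bottom_def)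

text \<open>A column with bottom entry 1 does not descend, so if the height is 0 on one side of it, then it is 0
  before it.\<close>

lemma bottom_plus_not_inside_blocks:
  assumes "1 \<le> j" "j \<le> length \<omega>"
  shows "has_bottom Plus (col \<omega> j) \<and> \<not> inside_block \<omega> j \<longleftrightarrow>
    has_bottom Plus (col \<omega> j) \<and> height (take (j - 1) \<omega>) = 0"
  unfolding inside_block_iff[OF assms]
  using take_height_nonneg[of j] take_height_nonneg[of "j - 1"] height_take_Suc[of j \<omega>] assms
  by (cases "col \<omega> j" rule: rise.cases) (auto simp: has_bottom_def)

lemma card_z_labels: "card (z_labels \<omega>) = z_count 0 \<omega>"
proof -
  have z: "z_labels \<omega> = {j \<in> {1..length \<omega>}. col \<omega> j = pm \<and> height (take (j - 1) \<omega>) = 0 \<and>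
      (\<forall>l<length \<omega>. col \<omega> (Suc l) = Zero \<longrightarrow> l < j - 1)}"
    (is "_ = ?Z")
  proof (rule set_eqI)
    fix j
    have "right_of_zeros \<omega> j \<longleftrightarrow> (\<forall>l<length \<omega>. col \<omega> (Suc l) = Zero \<longrightarrow> l < j - 1)" if "1 \<le> j"
      unfolding right_of_zeros_def all_columns_shift using that by auto
    thus "j \<in> z_labels \<omega> \<longleftrightarrow> j \<in> ?Z"
      using bottom_minus_outside_blocks[of j] unfolding z_labels_def by auto
  qed
  show ?thesis
    unfolding z_count_eq_card z card_columns_shift by (simp add: col_def)
qed

lemma z'_labels_eq: "z'_labels \<omega> = {j \<in> {1..length \<omega>}. col \<omega> j = pm \<and> height (take (j - 1) \<omega>) = 0 \<and> left_of_zeros \<omega> j}"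
  using bottom_minus_outside_blocks by (auto simp: z'_labels_def)

lemma card_y_labels: "card (y_labels \<omega>) = y_count 0 \<omega>"
proof -
  have y: "y_labels \<omega> = {j \<in> {1..length \<omega>}. has_bottom Plus (col \<omega> j) \<and> height (take (j - 1) \<omega>) = 0 \<and>
      (\<forall>l\<le>j - 1. col \<omega> (Suc l) \<noteq> Zero) \<and> (\<forall>l<j - 1. \<not> (col \<omega> (Suc l) = pm \<and> height (take l \<omega>) = 0))}"
    (is "_ = ?Y")
  proof (rule set_eqI)
    fix j
    show "j \<in> y_labels \<omega> \<longleftrightarrow> j \<in> ?Y"
    proof (cases "j \<in> {1..length \<omega>}")
      case True
      have left: "left_of_zeros \<omega> j \<longleftrightarrow> (\<forall>l\<le>j - 1. col \<omega> (Suc l) \<noteq> Zero)"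
      proof -
        have "left_of_zeros \<omega> j \<longleftrightarrow> (\<forall>l<length \<omega>. col \<omega> (Suc l) = Zero \<longrightarrow> j < Suc l)"
          unfolding left_of_zeros_def all_columns_shift ..
        also have "\<dots> \<longleftrightarrow> (\<forall>l\<le>j - 1. col \<omega> (Suc l) \<noteq> Zero)"
        proof (intro iffI allI impI)
          fix l assume "\<forall>l<length \<omega>. col \<omega> (Suc l) = Zero \<longrightarrow> j < Suc l" "l \<le> j - 1"
          moreover have "l < length \<omega>" "\<not> j < Suc l" using \<open>l \<le> j - 1\<close> True by auto
          ultimately show "col \<omega> (Suc l) \<noteq> Zero" by blast
        next
          fix l assume "\<forall>l\<le>j - 1. col \<omega> (Suc l) \<noteq> Zero" "col \<omega> (Suc l) = Zero"
          hence "\<not> l \<le> j - 1" by blast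
          thus "j < Suc l" by simp
        qed
        finally show ?thesis .
      qed
      have "(\<forall>k\<in>z'_labels \<omega>. \<not> k < j) \<longleftrightarrow> (\<forall>l<j - 1. \<not> (col \<omega> (Suc l) = pm \<and> height (take l \<omega>) = 0))"
        if "left_of_zeros \<omega> j"
      proof -
        have "left_of_zeros \<omega> k" if "k < j" for k
          using \<open>left_of_zeros \<omega> j\<close> that by (auto simp: left_of_zeros_def)
        hence "(\<forall>k\<in>z'_labels \<omega>. \<not> k < j) \<longleftrightarrow>
            (\<forall>k\<in>{1..length \<omega>}. k < j \<longrightarrow> \<not> (col \<omega> k = pm \<and> height (take (k - 1) \<omega>) = 0))"
          unfolding z'_labels_eq by blast
        also have "\<dots> \<longleftrightarrow> (\<forall>l<j - 1. \<not> (col \<omega> (Suc l) = pm \<and> height (take l \<omega>) = 0))"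
          unfolding all_columns_shift using True by auto
        finally show ?thesis .
      qed
      thus ?thesis
        using True left bottom_plus_not_inside_blocks[of j] unfolding y_labels_def mem_Collect_eq
        by (metis (no_types, lifting) atLeastAtMost_iff)
    qed (auto simp: y_labels_def)
  qed
  show ?thesis
    unfolding y_count_eq_card y card_columns_shift by (simp add: col_def)
qed

end

text \<open>The form of the weight in which the effect of a move is computed.\<close>

lemma weight_eq:
  assumes "admissible \<omega>"
  shows "weight \<alpha> \<alpha>\<^sub>s \<beta> \<beta>\<^sub>s \<omega> = inverse \<alpha> ^ y_count 0 \<omega> * inverse \<alpha>\<^sub>s ^ of_bool (hd \<omega> = Star) *
     inverse \<beta> ^ z_count 0 \<omega> * inverse \<beta>\<^sub>s ^ of_bool (last \<omega> = Star)"
proof -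
  have "\<omega> \<noteq> []" using assms by (simp add: admissible_def)
  hence "col \<omega> 1 = hd \<omega>" "col \<omega> (length \<omega>) = last \<omega>"
    by (simp_all add: col_def hd_conv_nth last_conv_nth)
  thus ?thesis
    by (simp add: weight_def card_y_labels[OF assms] card_z_labels[OF assms] n_y_star_def n_z_star_def)
qed

section \<open>Moves as rewriting of lists\<close>

text \<open>Filling a vacant position that is followed by the columns \<open>Q\<close>.  This either inserts \<open>pm\<close> or splits \<open>mp\<close>
  into \<open>pp\<close> and \<open>mm\<close>, so the total rise remains the same.\<close>

fun refill :: "column list \<Rightarrow> column list" where
  "refill (Spins Minus b # Q) = Spins Plus b # mm # Q"
| "refill Q = pm # Q"

text \<open>The columns \<open>X\<close> at the wall where a shift to the right is triggered, the column \<open>y\<close> that remains of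
  them, and the columns \<open>Q\<close> after them; the rules are \<open>B1\<close>, \<open>R1\<close> and \<open>R2\<close>.\<close>

inductive pick_left :: "column list \<Rightarrow> column \<Rightarrow> column list \<Rightarrow> bool" where
  "\<not> has_top Minus x \<Longrightarrow> x \<noteq> Star \<Longrightarrow> Q \<noteq> [] \<Longrightarrow> pick_left [x, mp] x Q"
| "pick_left [pm, Star] Star []"
| "pick_left [Zero, Star] Zero []"

text \<open>The columns \<open>P\<close> before the wall where a shift to the left is triggered, the columns \<open>X\<close> at that wall,
  and the column \<open>y\<close> that remains of them; the rules are the two forms of \<open>B2\<close>, \<open>L1\<close> and \<open>L2\<close>.\<close>

inductive pick_right :: "column list \<Rightarrow> column list \<Rightarrow> column \<Rightarrow> bool" where
  "P \<noteq> [] \<Longrightarrow> pick_right P [Spins Plus b, mm] (Spins Minus b)"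
| "P \<noteq> [] \<Longrightarrow> pick_right P [pm, Zero] Zero"
| "pick_right [] [Star, mp] Star"
| "pick_right [] [Star, Zero] Zero"

text \<open>A move from \<open>\<omega>\<close> at wall \<open>i\<close> to \<open>\<omega>'\<close>, together with the wall \<open>j\<close> of \<open>\<omega>'\<close> at which it ends.  The columns
  \<open>M\<close> and \<open>U\<close> are those that are shifted; they form a maximal run of columns with the given top entry,
  which is what makes the decomposition unique.\<close>

inductive sweep :: "column list \<Rightarrow> nat \<Rightarrow> column list \<Rightarrow> nat \<Rightarrow> bool" where
  left: "P \<noteq> [] \<Longrightarrow> \<not> has_top Minus (last P) \<Longrightarrow> \<forall>c\<in>set M. has_top Minus c \<Longrightarrow> pick_left X y Q \<Longrightarrow>
    sweep (P @ M @ X @ Q) (Suc (length P + length M)) (P @ mp # M @ y # Q) (length P)"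
| right: "\<forall>c\<in>set U. has_top Plus c \<Longrightarrow> Q \<noteq> [] \<Longrightarrow> \<not> has_top Plus (hd Q) \<Longrightarrow> pick_right P X y \<Longrightarrow>
    sweep (P @ X @ U @ Q) (Suc (length P)) (P @ y # U @ refill Q) (length P + length U + 2)"
| left_corner: "Q \<noteq> [] \<Longrightarrow> sweep (Zero # mp # Q) (Suc 0) (Star # Zero # Q) (Suc 0)"
| right_corner: "P \<noteq> [] \<Longrightarrow> sweep (P @ [pm, Zero]) (Suc (length P)) (P @ [Zero, Star]) (Suc (length P))"

lemma has_top_simps [simp]:
  "has_top a (Spins a' b) \<longleftrightarrow> a = a'" "\<not> has_top a Zero" "\<not> has_top a Star"
  by (auto simp: has_top_def)

lemma has_bottom_simps [simp]:
  "has_bottom b (Spins a b') \<longleftrightarrow> b = b'" "\<not> has_bottom b Zero" "\<not> has_bottom b Star"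
  by (auto simp: has_bottom_def)

lemma not_top_minus_cases:
  assumes "\<not> has_top Minus c"
  obtains "c = Zero" | "c = Star" | "c = pp" | "c = pm"
  using assms by (cases c rule: rise.cases) auto

lemma not_top_plus_cases:
  assumes "\<not> has_top Plus c"
  obtains "c = Zero" | "c = Star" | "c = mp" | "c = mm"
  using assms by (cases c rule: rise.cases) auto

lemma move_at_bulk:
  "P \<noteq> [] \<Longrightarrow> R \<noteq> [] \<Longrightarrow> move_at (P @ c # d # R) (Suc (length P)) =
    (case (c, d) of
          (Spins Plus b, Spins Minus Plus) \<Rightarrow> B1
        | (Zero, Spins Minus Plus) \<Rightarrow> B1
        | (Spins Plus b, Spins Minus Minus) \<Rightarrow> B2_spin b
        | (Spins Plus Minus, Zero) \<Rightarrow> B2_zero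
        | _ \<Rightarrow> No_move)"
  by (cases P; cases R) (simp_all add: move_at_def Let_def col_def nth_append)

lemma move_at_left:
  "R \<noteq> [] \<Longrightarrow> move_at (c # d # R) (Suc 0) =
    (case (c, d) of
          (Star, Spins Minus Plus) \<Rightarrow> L1
        | (Star, Zero) \<Rightarrow> L2
        | (Zero, Spins Minus Plus) \<Rightarrow> L3
        | _ \<Rightarrow> No_move)"
  by (cases R) (simp_all add: move_at_def Let_def col_def)

lemma move_at_right:
  "P \<noteq> [] \<Longrightarrow> move_at (P @ [c, d]) (Suc (length P)) =
    (case (c, d) of
          (Spins Plus Minus, Star) \<Rightarrow> R1
        | (Zero, Star) \<Rightarrow> R2
        | (Spins Plus Minus, Zero) \<Rightarrow> R3
        | _ \<Rightarrow> No_move)"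
  by (cases P) (simp_all add: move_at_def Let_def col_def nth_append)

lemma left_end_eq:
  assumes "P \<noteq> []" "\<not> has_top Minus (last P)" "\<forall>c\<in>set M. has_top Minus c"
  shows "left_end (P @ M @ R) (Suc (length P + length M)) = length P"
  unfolding left_end_def
proof (rule Min_eqI)
  let ?S = "{j \<in> {1..Suc (length P + length M) - 1}.
      \<forall>k\<in>{j + 1..Suc (length P + length M) - 1}. has_top Minus (col (P @ M @ R) k)}"
  show "length P \<in> ?S"
    using assms by (auto simp: col_def nth_append Suc_le_eq)
  fix j assume j: "j \<in> ?S"
  show "length P \<le> j"
  proof (rule ccontr)
    assume "\<not> length P \<le> j"
    hence "has_top Minus (col (P @ M @ R) (length P))" using j by auto
    thus False using assms by (simp add: col_def nth_append last_conv_nth)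
  qed
qed simp

lemma right_end_eq:
  assumes "Q \<noteq> []" "\<not> has_top Plus (hd Q)" "\<forall>c\<in>set U. has_top Plus c"
  shows "right_end (P @ c # d # U @ Q) (Suc (length P)) = length P + length U + 2"
  unfolding right_end_def
proof (rule Max_eqI)
  let ?w = "P @ c # d # U @ Q"
  let ?S = "{j \<in> {Suc (length P) + 1..length ?w - 1}. \<forall>k\<in>{Suc (length P) + 2..j}. has_top Plus (col ?w k)}"
  have U: "col ?w k = U ! (k - length P - 3)" if "k \<ge> length P + 3" "k \<le> length P + length U + 2" for k
    using that by (auto simp: col_def nth_append nth_Cons' numeral_eq_Suc)
  have "length Q \<ge> 1" using assms(1) by (simp add: Suc_le_eq)
  show "length P + length U + 2 \<in> ?S"
    using assms \<open>length Q \<ge> 1\<close> by (auto simp: U)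
  fix j assume j: "j \<in> ?S"
  show "j \<le> length P + length U + 2"
  proof (rule ccontr)
    assume "\<not> ?thesis"
    hence "has_top Plus (col ?w (length P + length U + 3))" using j by auto
    thus False using assms by (simp add: col_def nth_append hd_conv_nth)
  qed
qed simp

lemma length_shift [simp]: "length (shift_right w a b) = length w" "length (shift_left w a b) = length w"
  by (simp_all add: shift_right_def shift_left_def del: upt_Suc)

lemma nth_shift:
  assumes "k < length w"
  shows "shift_right w a b ! k = (if a \<le> k \<and> k \<le> b then w ! (k - 1) else w ! k)"
    and "shift_left w a b ! k = (if a \<le> k + 2 \<and> k + 2 \<le> b then w ! Suc k else w ! k)"
  using assms by (auto simp: shift_right_def shift_left_def col_def simp del: upt_Suc)

text \<open>The moves \<open>B1\<close>, \<open>R1\<close> and \<open>R2\<close> are instances of this one: a column \<open>d\<close> is removed and a column \<open>c\<close> is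
  inserted further left.\<close>

lemma shift_right_insert:
  "put (shift_right (P @ M @ d # Q) (length P + 1) (length P + length M)) (length P + 1) c = P @ c # M @ Q"
proof (rule nth_equalityI)
  let ?w = "P @ M @ d # Q"
  let ?l = "put (shift_right ?w (length P + 1) (length P + length M)) (length P + 1) c"
  have len: "length ?l = length ?w" by (simp add: put_def)
  show "length ?l = length (P @ c # M @ Q)" by (simp add: put_def)
  have nth: "?l ! k = (if k = length P then c else
      if length P < k \<and> k \<le> length P + length M then ?w ! (k - 1) else ?w ! k)" if "k < length ?w" for k
    unfolding put_def using that by (auto simp: nth_shift nth_list_update)
  fix k assume "k < length ?l"
  hence k: "k < length ?w" using len by simp
  consider "k \<le> length P" | m where "k = Suc (length P + m)" "m < length M" | m where "k = Suc (length P + length M + m)"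
  proof -
    assume *: "k \<le> length P \<Longrightarrow> thesis" "\<And>m. k = Suc (length P + m) \<Longrightarrow> m < length M \<Longrightarrow> thesis"
      "\<And>m. k = Suc (length P + length M + m) \<Longrightarrow> thesis"
    show thesis
    proof (cases "k \<le> length P")
      case False
      thus ?thesis using *(2)[of "k - length P - 1"] *(3)[of "k - length P - length M - 1"] by linarith
    qed (use * in blast)
  qed
  thus "?l ! k = (P @ c # M @ Q) ! k"
    unfolding nth[OF k] by cases (simp_all add: nth_append)
qed

text \<open>The last shifted column stays duplicated at the vacant position until that is filled.\<close>

lemma shift_left_delete:
  "shift_left (P @ d # U @ Q) (length P + 2) (length P + 1 + length U) = P @ U @ last (d # U) # Q"
proof (rule nth_equalityI)
  let ?w = "P @ d # U @ Q"
  let ?l = "shift_left ?w (length P + 2) (length P + 1 + length U)"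
  show "length ?l = length (P @ U @ last (d # U) # Q)" by simp
  fix k assume "k < length ?l"
  hence "k < length ?w" by simp
  hence nth: "?l ! k = (if length P \<le> k \<and> k < length P + length U then ?w ! Suc k else ?w ! k)"
    by (auto simp: nth_shift)
  consider "k < length P" | m where "k = length P + m" "m < length U" | "k = length P + length U"
    | m where "k = Suc (length P + length U + m)"
  proof -
    assume *: "k < length P \<Longrightarrow> thesis" "\<And>m. k = length P + m \<Longrightarrow> m < length U \<Longrightarrow> thesis"
      "k = length P + length U \<Longrightarrow> thesis" "\<And>m. k = Suc (length P + length U + m) \<Longrightarrow> thesis"
    show thesis
    proof (cases "k \<le> length P + length U")
      case True
      thus ?thesis using *(1,3) *(2)[of "k - length P"] by linarith
    next
      case False
      thus ?thesis using *(4)[of "k - length P - length U - 1"] by linarith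
    qed
  qed
  thus "?l ! k = (P @ U @ last (d # U) # Q) ! k"
  proof cases
    case 3
    have "(d # U) ! length U = last (d # U)" by (simp add: last_conv_nth)
    thus ?thesis unfolding nth using 3 by (cases U rule: rev_cases) (auto simp: nth_append)
  qed (unfold nth, simp_all add: nth_append)
qed

lemma fill_eq:
  assumes "Q \<noteq> []"
  shows "fill (P @ x # Q) (Suc (length P)) = P @ refill Q"
proof -
  obtain q Q' where "Q = q # Q'" using assms by (cases Q) auto
  thus ?thesis
    by (cases q rule: rise.cases) (auto simp: fill_def col_def put_def nth_append list_update_append)
qed

lemma fill_shift_left:
  "Q \<noteq> [] \<Longrightarrow> fill (shift_left (P @ d # U @ Q) (length P + 2) (length P + 1 + length U)) (length P + 1 + length U)
    = P @ U @ refill Q"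
  using fill_eq[of Q "P @ U" "last (d # U)"] unfolding shift_left_delete by simp

lemma T_star_sweep:
  assumes "sweep \<omega> i \<omega>' j"
  shows "T_star \<omega> i = \<omega>'"
  using assms
proof cases
  case (left P M X y Q)
  have le: "left_end \<omega> i = length P" unfolding left(1,2) by (rule left_end_eq[OF left(5-7)])
  from left(8) show ?thesis
  proof cases
    case 1
    hence "move_at \<omega> i = B1"
      using move_at_bulk[of "P @ M" Q y mp] left by (elim not_top_minus_cases) auto
    thus ?thesis
      using shift_right_insert[of P "M @ [y]" mp Q mp] le left 1 by (simp add: T_star_def)
  next
    case 2
    hence "move_at \<omega> i = R1"
      using move_at_right[of "P @ M" pm Star] left by auto
    thus ?thesis
      using shift_right_insert[of P M pm "[Star]" mp] le left 2 by (simp add: T_star_def)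
  next
    case 3
    hence "move_at \<omega> i = R2"
      using move_at_right[of "P @ M" Zero Star] left by auto
    thus ?thesis
      using shift_right_insert[of P "M @ [Zero]" Star "[]" mp] le left 3 by (simp add: T_star_def)
  qed
next
  case (right U Q P X y)
  have re: "right_end \<omega> i = length P + length U + 2" if "X = [c, d]" for c d
    unfolding right(1,2) that using right_end_eq[OF right(6,7,5), of P c d] by simp
  from right(8) show ?thesis
  proof cases
    case (1 b)
    hence "move_at \<omega> i = B2_spin b"
      using move_at_bulk[of P "U @ Q" "Spins Plus b" mm] right by (cases b) auto
    thus ?thesis
      using fill_shift_left[of Q "P @ [Spins Minus b]" mm U] re right 1
      by (simp add: T_star_def put_def)
  next
    case 2
    hence "move_at \<omega> i = B2_zero"
      using move_at_bulk[of P "U @ Q"] right by auto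
    thus ?thesis
      using fill_shift_left[of Q "P @ [Zero]" Zero U] re right 2
      by (simp add: T_star_def put_def)
  next
    case 3
    hence "move_at \<omega> i = L1"
      using move_at_left[of "U @ Q"] right by auto
    thus ?thesis
      using fill_shift_left[of Q "[Star]" mp U] re right 3 by (simp add: T_star_def eval_nat_numeral)
  next
    case 4
    hence "move_at \<omega> i = L2"
      using move_at_left[of "U @ Q"] right by auto
    thus ?thesis
      using fill_shift_left[of Q "[Zero]" Zero U] re right 4 by (simp add: T_star_def put_def eval_nat_numeral)
  qed
next
  case (left_corner Q)
  thus ?thesis using move_at_left[of Q Zero mp] by (simp add: T_star_def put_def)
next
  case (right_corner P)
  thus ?thesis using move_at_right[of P pm Zero] by (simp add: T_star_def put_def list_update_append)
qed

lemma split_last_not: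
  assumes "xs \<noteq> []" "\<not> Q (hd xs)"
  obtains P M where "xs = P @ M" "P \<noteq> []" "\<not> Q (last P)" "\<forall>c\<in>set M. Q c"
proof -
  have "\<exists>P M. xs = P @ M \<and> P \<noteq> [] \<and> \<not> Q (last P) \<and> (\<forall>c\<in>set M. Q c)"
    using assms
  proof (induction xs rule: rev_induct)
    case (snoc x xs)
    show ?case
    proof (cases "Q x")
      case False
      thus ?thesis by (intro exI[of _ "xs @ [x]"] exI[of _ "[]"]) simp
    next
      case True
      hence "xs \<noteq> []" using snoc.prems by auto
      then obtain P M where "xs = P @ M \<and> P \<noteq> [] \<and> \<not> Q (last P) \<and> (\<forall>c\<in>set M. Q c)" using snoc by auto
      thus ?thesis using True by (intro exI[of _ P] exI[of _ "M @ [x]"]) auto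
    qed
  qed simp
  thus thesis using that by blast
qed

lemma split_first_not:
  assumes "xs \<noteq> []" "\<not> Q (last xs)"
  obtains U R where "xs = U @ R" "R \<noteq> []" "\<not> Q (hd R)" "\<forall>c\<in>set U. Q c"
proof (rule that)
  show "xs = takeWhile Q xs @ dropWhile Q xs" by simp
  show "dropWhile Q xs \<noteq> []" using assms by (auto simp: dropWhile_eq_Nil_conv)
  thus "\<not> Q (hd (dropWhile Q xs))" by (rule hd_dropWhile)
qed (auto dest: set_takeWhileD)

text \<open>The run of columns that a move shifts ends inside the configuration, because the first and the
  last column have no top entry.\<close>

lemma sweep_exists:
  assumes adm: "admissible \<omega>" and n: "3 \<le> length \<omega>" and i: "1 \<le> i" "i < length \<omega>"
    and active: "move_at \<omega> i \<noteq> No_move"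
  obtains \<omega>' j where "sweep \<omega> i \<omega>' j"
proof -
  define A where "A = take (i - 1) \<omega>"
  define R where "R = drop (i + 1) \<omega>"
  define c d where "c = \<omega> ! (i - 1)" and "d = \<omega> ! i"
  have \<omega>: "\<omega> = A @ c # d # R"
    using id_take_nth_drop[of "i - 1" \<omega>] Cons_nth_drop_Suc[of i \<omega>] i
    by (simp add: A_def R_def c_def d_def)
  have iA: "i = Suc (length A)" using i by (simp add: A_def)
  have hd: "hd \<omega> \<in> {Zero, Star}" and last: "last \<omega> \<in> {Zero, Star}"
    using adm unfolding admissible_def by blast+
  have leftsplit: "\<exists>P M. A = P @ M \<and> P \<noteq> [] \<and> \<not> has_top Minus (last P) \<and> (\<forall>c\<in>set M. has_top Minus c)" if "A \<noteq> []"
  proof -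
    have "\<not> has_top Minus (hd A)" using hd that unfolding \<omega> by auto
    from split_last_not[of A "has_top Minus", OF that this] show ?thesis by blast
  qed
  have rightsplit: "\<exists>U Q. R = U @ Q \<and> Q \<noteq> [] \<and> \<not> has_top Plus (hd Q) \<and> (\<forall>c\<in>set U. has_top Plus c)" if "R \<noteq> []"
  proof -
    have "\<not> has_top Plus (last R)" using last that unfolding \<omega> by auto
    from split_first_not[of R "has_top Plus", OF that this] show ?thesis by blast
  qed
  have l: "\<exists>\<omega>' j. sweep \<omega> i \<omega>' j" if "A \<noteq> []" "pick_left [c, d] y R" for y
  proof -
    from leftsplit[OF that(1)] obtain P M where *: "A = P @ M" "P \<noteq> []" "\<not> has_top Minus (last P)" "\<forall>c\<in>set M. has_top Minus c"
      by blast
    show ?thesis using sweep.left[OF *(2,3,4) that(2)] unfolding \<omega> iA *(1) by auto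
  qed
  have r: "\<exists>\<omega>' j. sweep \<omega> i \<omega>' j" if "R \<noteq> []" "pick_right A [c, d] y" for y
  proof -
    from rightsplit[OF that(1)] obtain U Q where *: "R = U @ Q" "Q \<noteq> []" "\<not> has_top Plus (hd Q)" "\<forall>c\<in>set U. has_top Plus c"
      by blast
    show ?thesis using sweep.right[OF *(4,2,3) that(2)] unfolding \<omega> iA *(1) by auto
  qed
  consider "A = []" | "A \<noteq> []" "R \<noteq> []" | "A \<noteq> []" "R = []" by blast
  hence "\<exists>\<omega>' j. sweep \<omega> i \<omega>' j"
  proof cases
    case 1
    hence "R \<noteq> []" using n \<omega> by (cases R) auto
    have "(c, d) \<in> {(Star, mp), (Star, Zero), (Zero, mp)}"
      using active move_at_left[OF \<open>R \<noteq> []\<close>, of c d] \<omega> iA 1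
      by (cases c rule: rise.cases; cases d rule: rise.cases) simp_all
    thus ?thesis
      using r[OF \<open>R \<noteq> []\<close>] sweep.left_corner[OF \<open>R \<noteq> []\<close>] pick_right.intros 1 \<omega> iA by auto
  next
    case 2
    have "(\<exists>b. (c, d) = (Spins Plus b, mp)) \<or> (c, d) = (Zero, mp) \<or> (\<exists>b. (c, d) = (Spins Plus b, mm)) \<or> (c, d) = (pm, Zero)"
      using active move_at_bulk[OF 2, of c d] \<omega> iA
      by (cases c rule: rise.cases; cases d rule: rise.cases) simp_all
    thus ?thesis
    proof (elim disjE exE)
      fix b assume "(c, d) = (Spins Plus b, mm)"
      thus ?thesis using r[OF 2(2), of "Spins Minus b"] pick_right.intros(1)[OF 2(1)] by simp
    next
      assume "(c, d) = (pm, Zero)"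
      thus ?thesis using r[OF 2(2), of Zero] pick_right.intros(2)[OF 2(1)] by simp
    qed (use l[OF 2(1), of c] pick_left.intros(1)[OF _ _ 2(2), of c] in auto)
  next
    case 3
    have "(c, d) \<in> {(pm, Star), (Zero, Star), (pm, Zero)}"
      using active move_at_right[OF 3(1), of c d] \<omega> iA 3(2)
      by (cases c rule: rise.cases; cases d rule: rise.cases) simp_all
    thus ?thesis
      using l[OF 3(1)] pick_left.intros(2,3) sweep.right_corner[OF 3(1)] \<omega> iA 3(2) by auto
  qed
  thus thesis using that by blast
qed

section \<open>Moves can be undone\<close>

lemma dyck_refill: "0 \<le> h \<Longrightarrow> dyck h (refill Q) \<longleftrightarrow> dyck h Q"
proof (cases Q rule: refill.cases)
  case (1 b R)
  thus "0 \<le> h \<Longrightarrow> ?thesis" by (cases b) auto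
qed auto

lemma refill_simps [simp]:
  "refill (mp # Q) = pp # mm # Q" "refill (mm # Q) = pm # mm # Q"
  "refill (Zero # Q) = pm # Zero # Q" "refill (Star # Q) = pm # Star # Q"
  by simp_all

lemma last_refill: "Q \<noteq> [] \<Longrightarrow> last Q \<in> {Zero, Star} \<Longrightarrow> last (refill Q) = last Q"
  by (cases Q rule: refill.cases) auto

lemma admissible_middle:
  assumes "P \<noteq> []" "Q \<noteq> []"
  shows "admissible (P @ W @ Q) \<longleftrightarrow> hd P \<in> {Zero, Star} \<and> last Q \<in> {Zero, Star} \<and>
    Star \<notin> set (tl P) \<and> Star \<notin> set W \<and> Star \<notin> set (butlast Q) \<and> dyck 0 (P @ W @ Q)"
  using assms by (cases P) (auto simp: admissible_def butlast_append)

lemma set_butlast_refill: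
  assumes "Q \<noteq> []" "\<not> has_top Plus (hd Q)" "last Q \<in> {Zero, Star}"
  shows "Star \<in> set (butlast (refill Q)) \<longleftrightarrow> Star \<in> set (butlast Q)"
  using assms by (cases Q rule: refill.cases) auto

text \<open>The columns that are inserted and deleted have rise 0; where two columns are merged or one is split, the
  total rise is kept, and a split column \<open>mp\<close> makes the path rise before it descends.  So the heights at
  all other columns are as before, and no height becomes negative.\<close>

lemma sweep_admissible:
  assumes "sweep \<omega> i \<omega>' j" "admissible \<omega>"
  shows "admissible \<omega>'"
  using assms(1)
proof cases
  case (left P M X y Q)
  note adm = assms(2)[unfolded left(1)]
  from left(8) show ?thesis
  proof cases
    case 1
    thus ?thesis using adm left admissible_middle[of P Q "M @ [y, mp]"] admissible_middle[of P Q "mp # M @ [y]"]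
      by (auto dest: dyck_nonneg)
  next
    case 2
    thus ?thesis using adm left admissible_middle[of P "[Star]" "M @ [pm]"] admissible_middle[of P "[Star]" "mp # M"]
      by (auto dest: dyck_nonneg)
  next
    case 3
    thus ?thesis using adm left admissible_middle[of P "[Star]" "M @ [Zero]"] admissible_middle[of P "[Zero]" "mp # M"]
      by (auto dest: dyck_nonneg)
  qed
next
  case (right U Q P X y)
  note adm = assms(2)[unfolded right(1)]
  have rne: "refill Q \<noteq> []" by (cases Q rule: refill.cases) auto
  note r = last_refill[OF right(6)] set_butlast_refill[OF right(6,7)]
  from right(8) show ?thesis
  proof cases
    case (1 b)
    note am = admissible_middle[OF 1(3) right(6), of "Spins Plus b # mm # U"] admissible_middle[OF 1(3) rne, of "Spins Minus b # U"]
    show ?thesis using adm right am 1 r by (cases b) (auto simp: dyck_refill dest: dyck_nonneg)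
  next
    case 2
    note am = admissible_middle[OF 2(3) right(6), of "pm # Zero # U"] admissible_middle[OF 2(3) rne, of "Zero # U"]
    show ?thesis using adm right am 2 r by (auto simp: dyck_refill dest: dyck_nonneg)
  next
    case 3
    note am = admissible_middle[OF _ right(6), of "[Star]" "mp # U"] admissible_middle[OF _ rne, of "[Star]" U]
    show ?thesis using adm right am 3 r by (auto simp: dyck_refill dest: dyck_nonneg)
  next
    case 4
    note am = admissible_middle[OF _ right(6), of "[Star]" "Zero # U"] admissible_middle[OF _ rne, of "[Zero]" U]
    show ?thesis using adm right am 4 r by (auto simp: dyck_refill dest: dyck_nonneg)
  qed
next
  case (left_corner Q)
  thus ?thesis using assms(2) admissible_middle[of "[Zero]" Q "[mp]"] admissible_middle[of "[Star]" Q "[Zero]"]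
    by auto
next
  case (right_corner P)
  thus ?thesis using assms(2) admissible_middle[of P "[Zero]" "[pm]"] admissible_middle[of P "[Star]" "[Zero]"]
    by auto
qed

lemma count_refill: "count_list (refill Q) Zero = count_list Q Zero"
  by (cases Q rule: refill.cases) auto

lemma length_refill: "length (refill Q) = Suc (length Q)"
  by (cases Q rule: refill.cases) auto

lemma sweep_length_count:
  assumes "sweep \<omega> i \<omega>' j"
  shows "length \<omega>' = length \<omega>" "count_list \<omega>' Zero = count_list \<omega> Zero"
  using assms
  by (cases; auto elim!: pick_left.cases pick_right.cases simp: length_refill count_refill)+

lemma sweep_configs:
  assumes "sweep \<omega> i \<omega>' j" "\<omega> \<in> configs n n\<^sub>0" "2 \<le> n"
  shows "\<omega>' \<in> configs n n\<^sub>0"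
  using assms sweep_admissible[OF assms(1)] sweep_length_count[OF assms(1)]
  by (simp add: configs_iff)

lemma takeWhile_unique:
  assumes "\<forall>x\<in>set M. Q x" "\<forall>x\<in>set M'. Q x" "\<not> Q y" "\<not> Q y'" "M @ y # R = M' @ y' # R'"
  shows "M = M' \<and> y = y' \<and> R = R'"
proof -
  have "takeWhile Q (M @ y # R) = M" "takeWhile Q (M' @ y' # R') = M'"
    using assms(1-4) by simp_all
  hence "M = M'" using assms(5) by simp
  thus ?thesis using assms(5) by simp
qed

lemma pick_left_inj: "pick_left X y Q \<Longrightarrow> pick_left X' y Q \<Longrightarrow> X = X'"
  by (auto elim!: pick_left.cases)

lemma pick_right_inj: "pick_right P X y \<Longrightarrow> pick_right P X' y \<Longrightarrow> X = X'"
  by (auto elim!: pick_right.cases)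

lemma pick_left_not_top: "pick_left X y Q \<Longrightarrow> \<not> has_top Minus y"
  by (auto elim!: pick_left.cases)

lemma pick_right_not_top: "pick_right P X y \<Longrightarrow> \<not> has_top Plus y"
  by (auto elim!: pick_right.cases)

lemma refill_inj: "refill Q = refill Q' \<Longrightarrow> Q = Q'"
  by (cases Q rule: refill.cases; cases Q' rule: refill.cases) auto

lemma refill_cases:
  assumes "Q \<noteq> []" "\<not> has_top Plus (hd Q)"
  obtains a b R where "refill Q = Spins Plus a # b # R" "b \<in> {mm, Zero, Star}"
  using assms by (cases Q rule: refill.cases) auto

text \<open>The columns \<open>j\<close> and \<open>j + 1\<close> of the result distinguish the four kinds of moves.  For a shift to the
  right, \<open>M\<close> is the maximal run of columns with top entry -1 after column \<open>j + 1\<close>; for a shift to the left,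
  \<open>U\<close> is the maximal run of columns with top entry 1 before column \<open>j\<close>.\<close>

lemma sweep_inj:
  assumes "sweep \<omega>\<^sub>1 i\<^sub>1 \<omega>' j" "sweep \<omega>\<^sub>2 i\<^sub>2 \<omega>' j"
  shows "\<omega>\<^sub>1 = \<omega>\<^sub>2 \<and> i\<^sub>1 = i\<^sub>2"
proof -
  define lft where "lft \<omega> i \<longleftrightarrow> (\<exists>P M y Q X. \<omega>' = P @ mp # M @ y # Q \<and> j = length P \<and>
      \<omega> = P @ M @ X @ Q \<and> i = Suc (length P + length M) \<and> (\<forall>c\<in>set M. has_top Minus c) \<and> pick_left X y Q)" for \<omega> i
  define rgt where "rgt \<omega> i \<longleftrightarrow> (\<exists>P U Q X y. \<omega>' = P @ y # U @ refill Q \<and> j = length P + length U + 2 \<and>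
      \<omega> = P @ X @ U @ Q \<and> i = Suc (length P) \<and> (\<forall>c\<in>set U. has_top Plus c) \<and> pick_right P X y)" for \<omega> i
  have form: "lft \<omega> i \<and> \<omega>' ! j = mp
    \<or> rgt \<omega> i \<and> \<omega>' ! j \<in> {mm, Zero, Star} \<and> has_top Plus (\<omega>' ! (j - 1))
    \<or> (\<exists>Q. \<omega>' = Star # Zero # Q \<and> \<omega> = Zero # mp # Q \<and> i = 1) \<and> \<omega>' ! j = Zero \<and> \<omega>' ! (j - 1) = Star
    \<or> (\<exists>P. \<omega>' = P @ [Zero, Star] \<and> \<omega> = P @ [pm, Zero] \<and> i = j) \<and> \<omega>' ! j = Star \<and> \<omega>' ! (j - 1) = Zero"
    if "sweep \<omega> i \<omega>' j" for \<omega> i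
    using that
  proof cases
    case (left P M X y Q)
    hence "lft \<omega> i" unfolding lft_def by blast
    thus ?thesis using left by simp
  next
    case (right U Q P X y)
    hence "rgt \<omega> i" unfolding rgt_def by blast
    obtain a b R where R: "refill Q = Spins Plus a # b # R" "b \<in> {mm, Zero, Star}"
      using refill_cases[OF right(6,7)] by metis
    have "\<omega>' = (P @ y # U) @ Spins Plus a # b # R" "j = Suc (length (P @ y # U))" using right R by simp_all
    hence "\<omega>' ! j = b" "\<omega>' ! (j - 1) = Spins Plus a" by (auto simp: nth_append simp del: append_assoc)
    thus ?thesis using \<open>rgt \<omega> i\<close> R by simp
  qed (auto simp: nth_append)
  \<comment> \<open>The length of \<open>P\<close> is \<open>j\<close>, and \<open>M\<close> ends where the top entry is first not -1.\<close>
  have left_case: "\<omega>\<^sub>1 = \<omega>\<^sub>2 \<and> i\<^sub>1 = i\<^sub>2" if l: "lft \<omega>\<^sub>1 i\<^sub>1" "lft \<omega>\<^sub>2 i\<^sub>2"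
  proof -
    obtain P M y Q X where 1: "\<omega>' = P @ mp # M @ y # Q" "j = length P" "\<omega>\<^sub>1 = P @ M @ X @ Q"
        "i\<^sub>1 = Suc (length P + length M)" "\<forall>c\<in>set M. has_top Minus c" "pick_left X y Q"
      using l(1) unfolding lft_def by blast
    obtain P' M' y' Q' X' where 2: "\<omega>' = P' @ mp # M' @ y' # Q'" "j = length P'" "\<omega>\<^sub>2 = P' @ M' @ X' @ Q'"
        "i\<^sub>2 = Suc (length P' + length M')" "\<forall>c\<in>set M'. has_top Minus c" "pick_left X' y' Q'"
      using l(2) unfolding lft_def by blast
    have *: "P = P'" "M @ y # Q = M' @ y' # Q'" using 1(1,2) 2(1,2) by auto
    have **: "M = M' \<and> y = y' \<and> Q = Q'"
      using takeWhile_unique[OF 1(5) 2(5) _ _ *(2)] pick_left_not_top[OF 1(6)] pick_left_not_top[OF 2(6)] by simp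
    hence "X = X'" using pick_left_inj[OF 1(6)] 2(6) by simp
    thus ?thesis using 1(3,4) 2(3,4) *(1) ** by simp
  qed
  \<comment> \<open>Reading to the left from wall \<open>j\<close>, \<open>U\<close> ends where the top entry is first not 1.\<close>
  have right_case: "\<omega>\<^sub>1 = \<omega>\<^sub>2 \<and> i\<^sub>1 = i\<^sub>2" if r: "rgt \<omega>\<^sub>1 i\<^sub>1" "rgt \<omega>\<^sub>2 i\<^sub>2"
  proof -
    obtain P U Q X y where 1: "\<omega>' = P @ y # U @ refill Q" "j = length P + length U + 2" "\<omega>\<^sub>1 = P @ X @ U @ Q"
        "i\<^sub>1 = Suc (length P)" "\<forall>c\<in>set U. has_top Plus c" "pick_right P X y"
      using r(1) unfolding rgt_def by blast
    obtain P' U' Q' X' y' where 2: "\<omega>' = P' @ y' # U' @ refill Q'" "j = length P' + length U' + 2"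
        "\<omega>\<^sub>2 = P' @ X' @ U' @ Q'" "i\<^sub>2 = Suc (length P')" "\<forall>c\<in>set U'. has_top Plus c" "pick_right P' X' y'"
      using r(2) unfolding rgt_def by blast
    have "(P @ y # U) @ refill Q = (P' @ y' # U') @ refill Q'" "length (P @ y # U) = length (P' @ y' # U')"
      using 1(1,2) 2(1,2) by auto
    hence *: "P @ y # U = P' @ y' # U'" "refill Q = refill Q'" 
      using append_eq_append_conv[of "P @ y # U" "P' @ y' # U'" "refill Q" "refill Q'"] by blast+
    from *(1) have "rev (P @ y # U) = rev (P' @ y' # U')" by (rule arg_cong)
    hence "rev U @ y # rev P = rev U' @ y' # rev P'" by simp
    hence "rev U = rev U' \<and> y = y' \<and> rev P = rev P'"
      using takeWhile_unique[of "rev U" "has_top Plus" "rev U'" y y' "rev P" "rev P'"] 1(5,6) 2(5,6)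
        pick_right_not_top by simp
    hence "U = U'" "y = y'" "P = P'" by simp_all
    moreover from this have "X = X'" using pick_right_inj[OF 1(6)] 2(6) by simp
    ultimately show ?thesis using 1(3,4) 2(3,4) refill_inj[OF *(2)] by simp
  qed
  from form[OF assms(1)] show ?thesis
  proof (elim disjE)
    assume "lft \<omega>\<^sub>1 i\<^sub>1 \<and> \<omega>' ! j = mp"
    moreover from this have "lft \<omega>\<^sub>2 i\<^sub>2" using form[OF assms(2)] by (elim disjE) simp_all
    ultimately show ?thesis using left_case by simp
  next
    assume "rgt \<omega>\<^sub>1 i\<^sub>1 \<and> \<omega>' ! j \<in> {mm, Zero, Star} \<and> has_top Plus (\<omega>' ! (j - 1))"
    moreover from this have "rgt \<omega>\<^sub>2 i\<^sub>2" using form[OF assms(2)]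
      by (elim disjE conjE) (simp_all del: One_nat_def)
    ultimately show ?thesis using right_case by simp
  qed (use form[OF assms(2)] in \<open>elim disjE conjE exE; simp\<close>)+
qed

section \<open>Balance of rates and weights\<close>

lemma y_open_append: "y_open h (xs @ ys) \<longleftrightarrow> y_open h xs \<and> y_open (h + height xs) ys"
  by (induction xs arbitrary: h) (auto simp: add.assoc)

text \<open>A shift to the right inserts \<open>mp\<close> after a column that is not of top entry -1.  If that column is \<open>pp\<close>,
  then the height is positive; if it is \<open>pm\<close>, then the height is positive or the column is a \<open>z'\<close>-label; if
  it is a 0-column, then the scan has ended.  So the new column gets a \<open>y\<close>-label only after an initial
  \<open>*\<close>-column.\<close>

lemma y_count_insert_left:
  assumes "dyck 0 P" "P \<noteq> []" "\<not> has_top Minus (last P)" "Star \<notin> set (tl P)"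
  shows "y_count 0 (P @ mp # R) = y_count 0 (P @ R) + of_bool (P = [Star])"
proof -
  obtain P' c where P: "P = P' @ [c]" using assms(2) by (cases P rule: rev_cases) auto
  have "0 \<le> height P'" using assms(1) dyck_nonneg[of 0 P'] unfolding P by simp
  moreover have "P' = []" if "c = Star" using assms(4) that unfolding P by (cases P') auto
  ultimately have "height P > 0 \<or> P = [Star]" if "y_open 0 P"
    using that assms(3) unfolding P by (cases c rule: rise.cases) (auto simp: y_open_append)
  thus ?thesis by (auto simp: y_count_append)
qed

lemma z_count_insert_left: "z_count 0 (P @ mp # R) = z_count 0 (P @ R)"
  by (simp add: z_count_append)

text \<open>The column \<open>mp\<close> that \<open>B1\<close> removes has no label: it comes after a 0-column, after a \<open>z'\<close>-label, or at
  positive height.  The column \<open>pm\<close> that \<open>R1\<close> removes has a \<open>z\<close>-label, since the height is 0 at the final \<open>*\<close>-column.\<close>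

lemma counts_pick_left:
  assumes "pick_left X y Q" "dyck h (M @ X @ Q)" "0 \<le> h"
  shows "y_count h (M @ X @ Q) = y_count h (M @ y # Q)"
    and "z_count h (M @ X @ Q) = z_count h (M @ y # Q) + of_bool (X = [pm, Star])"
    and "height (X @ Q) = height (y # Q)" "Zero \<in> set (X @ Q) \<longleftrightarrow> Zero \<in> set (y # Q)"
proof -
  have h: "0 \<le> h + height M" using assms dyck_nonneg[of h M] by simp
  have "y_count (h + height M) (X @ Q) = y_count (h + height M) (y # Q) \<and>
      z_count (h + height M) (X @ Q) = z_count (h + height M) (y # Q) + of_bool (X = [pm, Star]) \<and>
      height (X @ Q) = height (y # Q) \<and> (Zero \<in> set (X @ Q) \<longleftrightarrow> Zero \<in> set (y # Q))"
    using assms(1)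
  proof cases
    case 1
    thus ?thesis using h by (elim not_top_minus_cases) auto
  qed (use assms(2) in auto)
  thus "y_count h (M @ X @ Q) = y_count h (M @ y # Q)"
    and "z_count h (M @ X @ Q) = z_count h (M @ y # Q) + of_bool (X = [pm, Star])"
    and "height (X @ Q) = height (y # Q)" "Zero \<in> set (X @ Q) \<longleftrightarrow> Zero \<in> set (y # Q)"
    by (simp_all add: y_count_append[of h M] z_count_append[of h M])
qed

text \<open>Positivity forces a column \<open>pm\<close> before \<open>mm\<close> to be at positive height, so that it has no label, and
  a column \<open>pm\<close> before a 0-column has no \<open>z\<close>-label either.  If \<open>pp\<close> before \<open>mm\<close> has a \<open>y\<close>-label, then the
  column \<open>mp\<close> in its place inherits it.  So a label is lost in \<open>L1\<close> only, where \<open>mp\<close> at height 0 is removed.\<close>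

lemma counts_pick_right:
  assumes "pick_right P X y" "dyck 0 (P @ X @ R)"
  shows "y_count 0 (P @ X @ R) = y_count 0 (P @ y # R) + of_bool (X = [Star, mp])"
    and "z_count 0 (P @ X @ R) = z_count 0 (P @ y # R)"
    and "dyck 0 (P @ y # R)"
proof -
  have h: "0 \<le> height P" using assms dyck_nonneg[of 0 P] by simp
  have "y_count 0 (P @ X @ R) = y_count 0 (P @ y # R) + of_bool (X = [Star, mp]) \<and>
      z_count 0 (P @ X @ R) = z_count 0 (P @ y # R) \<and> dyck 0 (P @ y # R)"
    using assms(1)
  proof cases
    case (1 b)
    thus ?thesis using h assms(2) by (cases b) (auto simp: y_count_append z_count_append)
  qed (use h assms(2) in \<open>auto simp: y_count_append z_count_append\<close>)
  thus "y_count 0 (P @ X @ R) = y_count 0 (P @ y # R) + of_bool (X = [Star, mp])"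
    and "z_count 0 (P @ X @ R) = z_count 0 (P @ y # R)" and "dyck 0 (P @ y # R)" by simp_all
qed

text \<open>An inserted column \<open>pm\<close> is followed by \<open>mm\<close>, which puts it at positive height, by a 0-column, or by the
  final \<open>*\<close>-column; only in the last case it gets a \<open>z\<close>-label.  When \<open>mp\<close> is split, \<open>pp\<close> inherits its label.\<close>

lemma counts_refill:
  assumes "dyck 0 (P @ Q)" "Q \<noteq> []" "\<not> has_top Plus (hd Q)" "Star \<notin> set (butlast Q)"
  shows "y_count 0 (P @ refill Q) = y_count 0 (P @ Q)"
    and "z_count 0 (P @ refill Q) = z_count 0 (P @ Q) + of_bool (Q = [Star])"
proof -
  have h: "0 \<le> height P" using assms dyck_nonneg[of 0 P] by simp
  obtain q Q' where Q: "Q = q # Q'" using assms(2) by (cases Q) auto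
  have "\<not> has_top Plus q" using assms(3) Q by simp
  moreover have "Q' = []" if "q = Star" using that assms(4) Q by (cases Q') auto
  ultimately show "y_count 0 (P @ refill Q) = y_count 0 (P @ Q)"
    and "z_count 0 (P @ refill Q) = z_count 0 (P @ Q) + of_bool (Q = [Star])"
    using h assms(1) unfolding Q
    by (auto elim!: not_top_plus_cases simp: y_count_append z_count_append)
qed

lemma rate_pick_left:
  assumes "pick_left X y Q" "A \<noteq> []"
  shows "rate \<alpha> \<alpha>\<^sub>s \<beta> \<beta>\<^sub>s (move_at (A @ X @ Q) (Suc (length A)))
      = (if X = [pm, Star] then \<beta> else if X = [Zero, Star] then \<beta>\<^sub>s else 1)"
  using assms
proof cases
  case 1
  thus ?thesis using move_at_bulk[OF assms(2), of Q y mp] by (elim not_top_minus_cases) auto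
qed (use move_at_right[OF assms(2)] in auto)

lemma rate_pick_right:
  assumes "pick_right P X y" "R \<noteq> []"
  shows "rate \<alpha> \<alpha>\<^sub>s \<beta> \<beta>\<^sub>s (move_at (P @ X @ R) (Suc (length P)))
      = (if X = [Star, mp] then \<alpha> else if X = [Star, Zero] then \<alpha>\<^sub>s else 1)"
  using assms
proof cases
  case (1 b)
  thus ?thesis using move_at_bulk[of P R "Spins Plus b" mm] assms(2) by (cases b) auto
next
  case 2
  thus ?thesis using move_at_bulk[of P R pm Zero] assms(2) by auto
qed (use move_at_left[OF assms(2)] in auto)

lemma move_after_left:
  assumes "P \<noteq> []" "\<not> has_top Minus (last P)" "hd P \<in> {Zero, Star}" "Star \<notin> set (tl P)" "R \<noteq> []"
  shows "move_at (P @ mp # R) (length P) \<noteq> No_move"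
    and "rate \<alpha> \<alpha>\<^sub>s \<beta> \<beta>\<^sub>s (move_at (P @ mp # R) (length P)) = (if P = [Star] then \<alpha> else 1)"
proof -
  obtain P' c where P: "P = P' @ [c]" using assms(1) by (cases P rule: rev_cases) auto
  have "move_at (P @ mp # R) (length P) = (if P = [Star] then L1 else if P = [Zero] then L3 else B1)"
  proof (cases "P' = []")
    case True
    thus ?thesis using move_at_left[OF assms(5), of c mp] assms(3) P by auto
  next
    case False
    moreover from this have "c \<noteq> Star" using assms(4) P by (cases P') auto
    ultimately show ?thesis
      using move_at_bulk[OF False assms(5), of c mp] assms(2) P
      by (cases c rule: rise.cases) auto
  qed
  thus "move_at (P @ mp # R) (length P) \<noteq> No_move"
    and "rate \<alpha> \<alpha>\<^sub>s \<beta> \<beta>\<^sub>s (move_at (P @ mp # R) (length P)) = (if P = [Star] then \<alpha> else 1)"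
    by simp_all
qed

lemma move_after_right:
  assumes "A \<noteq> []" "Q \<noteq> []" "\<not> has_top Plus (hd Q)" "last Q \<in> {Zero, Star}" "Star \<notin> set (butlast Q)"
  shows "move_at (A @ refill Q) (Suc (length A)) \<noteq> No_move"
    and "rate \<alpha> \<alpha>\<^sub>s \<beta> \<beta>\<^sub>s (move_at (A @ refill Q) (Suc (length A))) = (if Q = [Star] then \<beta> else 1)"
proof -
  obtain q Q' where Q: "Q = q # Q'" using assms(2) by (cases Q) auto
  have "move_at (A @ refill Q) (Suc (length A)) = (if Q = [Star] then R1 else if Q = [Zero] then R3 else
      if q = Zero then B2_zero else B2_spin (if q = mp then Plus else Minus))"
  proof (cases "Q' = []")
    case True
    thus ?thesis using move_at_right[OF assms(1), of pm q] assms(4) Q by auto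
  next
    case False
    hence "q \<noteq> Star" using assms(5) Q by auto
    thus ?thesis
      using move_at_bulk[OF assms(1) False] move_at_bulk[OF assms(1), of "mm # Q'"] assms(3) Q False
      by (cases q rule: rise.cases) auto
  qed
  thus "move_at (A @ refill Q) (Suc (length A)) \<noteq> No_move"
    and "rate \<alpha> \<alpha>\<^sub>s \<beta> \<beta>\<^sub>s (move_at (A @ refill Q) (Suc (length A))) = (if Q = [Star] then \<beta> else 1)"
    by simp_all
qed

text \<open>Each rate that is not 1 is matched by a change of weight.  Boundary moves from \<open>\<omega>\<close> remove a label or a
  \<open>*\<close>-column whose factor cancels their rate, and a move creates one exactly when it ends at a wall where
  the next move has the corresponding rate.\<close>

lemma sweep_balance:
  assumes sw: "sweep \<omega> i \<omega>' j" and adm: "admissible \<omega>"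
    and pos: "0 < \<alpha>" "0 < \<alpha>\<^sub>s" "0 < \<beta>" "0 < \<beta>\<^sub>s"
  shows "1 \<le> j \<and> j < length \<omega>' \<and> move_at \<omega>' j \<noteq> No_move \<and>
    rate \<alpha> \<alpha>\<^sub>s \<beta> \<beta>\<^sub>s (move_at \<omega> i) * weight \<alpha> \<alpha>\<^sub>s \<beta> \<beta>\<^sub>s \<omega> =
    rate \<alpha> \<alpha>\<^sub>s \<beta> \<beta>\<^sub>s (move_at \<omega>' j) * weight \<alpha> \<alpha>\<^sub>s \<beta> \<beta>\<^sub>s \<omega>'"
proof -
  note w = weight_eq[OF adm] weight_eq[OF sweep_admissible[OF sw adm]]
  have ends: "hd \<omega> \<in> {Zero, Star}" "last \<omega> \<in> {Zero, Star}" "Star \<notin> set (butlast (tl \<omega>))" "dyck 0 \<omega>"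
    using adm by (auto simp: admissible_def)
  from sw show ?thesis
  proof cases
    case (left P M X y Q)
    have X: "X @ Q \<noteq> []" using left(8) by (auto elim: pick_left.cases)
    have P: "hd P \<in> {Zero, Star}" "Star \<notin> set (tl P)" "dyck 0 P" "dyck (height P) (M @ X @ Q)"
      using ends left(5) X unfolding left(1) by (auto simp: butlast_append tl_append split: list.splits if_splits)
    have "0 \<le> height P" using dyck_nonneg[OF P(3)] by simp
    note c = counts_pick_left[OF left(8) P(4) this]
    have y: "y_count 0 \<omega>' = y_count 0 \<omega> + of_bool (P = [Star])"
      unfolding left using y_count_insert_left[OF P(3) left(5,6) P(2)] c(1)
      by (simp add: y_count_append[of 0 P])
    have z: "z_count 0 \<omega> = z_count 0 \<omega>' + of_bool (X = [pm, Star])"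
      unfolding left z_count_insert_left using c(2,4) by (simp add: z_count_append[of 0 P])
    have l: "of_bool (last \<omega> = Star) = (of_bool (last \<omega>' = Star) + of_bool (X = [Zero, Star]) :: nat)"
      using left(8) unfolding left(1,3) by cases auto
    have h: "hd \<omega>' = hd \<omega>" using left(5) unfolding left(1,3) by simp
    have r: "rate \<alpha> \<alpha>\<^sub>s \<beta> \<beta>\<^sub>s (move_at \<omega> i) = (if X = [pm, Star] then \<beta> else if X = [Zero, Star] then \<beta>\<^sub>s else 1)"
      unfolding left(1,2) using rate_pick_left[OF left(8), of "P @ M"] left(5) by simp
    note m = move_after_left[OF left(5,6) P(1,2), of "M @ y # Q", folded left(3,4)]
    have "rate \<alpha> \<alpha>\<^sub>s \<beta> \<beta>\<^sub>s (move_at \<omega> i) * weight \<alpha> \<alpha>\<^sub>s \<beta> \<beta>\<^sub>s \<omega> =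
        rate \<alpha> \<alpha>\<^sub>s \<beta> \<beta>\<^sub>s (move_at \<omega>' j) * weight \<alpha> \<alpha>\<^sub>s \<beta> \<beta>\<^sub>s \<omega>'"
      unfolding w y z l h r using m pos by (auto simp: power_add field_simps)
    moreover have "1 \<le> j \<and> j < length \<omega>'" using left by (auto simp: Suc_le_eq)
    ultimately show ?thesis using m by simp
  next
    case (right U Q P X y)
    have X: "dyck 0 (P @ X @ U @ Q)" "last Q \<in> {Zero, Star}" using ends right(6) unfolding right(1) by simp_all
    have Xn: "X \<noteq> []" "P = [] \<Longrightarrow> length X = 2" using right(8) by (auto elim: pick_right.cases)
    have star: "Star \<notin> set (butlast Q)"
      using ends(3) right(6) Xn unfolding right(1) by (cases P; cases X) (auto simp: butlast_append split: if_splits)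
    have dU: "dyck 0 ((P @ y # U) @ Q)"
      using counts_pick_right(3)[OF right(8) X(1)] by simp
    note c = counts_pick_right[OF right(8), of "U @ Q"]
    note f = counts_refill[OF dU right(6,7) star]
    have y: "y_count 0 \<omega> = y_count 0 \<omega>' + of_bool (X = [Star, mp])"
      unfolding right(1,3) using c(1)[OF X(1)] f(1) by simp
    have z: "z_count 0 \<omega>' = z_count 0 \<omega> + of_bool (Q = [Star])"
      unfolding right(1,3) using c(2)[OF X(1)] f(2) by simp
    have rne: "refill Q \<noteq> []" by (cases Q rule: refill.cases) auto
    have l: "last \<omega>' = last \<omega>"
      using last_refill[OF right(6) X(2)] rne right(6) unfolding right(1,3) by simp
    have h: "of_bool (hd \<omega> = Star) = (of_bool (hd \<omega>' = Star) + of_bool (X = [Star, Zero]) :: nat)"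
      using right(8) unfolding right(1,3) by cases auto
    have r: "rate \<alpha> \<alpha>\<^sub>s \<beta> \<beta>\<^sub>s (move_at \<omega> i) = (if X = [Star, mp] then \<alpha> else if X = [Star, Zero] then \<alpha>\<^sub>s else 1)"
      unfolding right(1,2) using rate_pick_right[OF right(8), of "U @ Q"] right(6) by simp
    have j: "\<omega>' = (P @ y # U) @ refill Q" "j = Suc (length (P @ y # U))" using right by simp_all
    note m = move_after_right[OF _ right(6,7) X(2) star, of "P @ y # U", folded j]
    have "rate \<alpha> \<alpha>\<^sub>s \<beta> \<beta>\<^sub>s (move_at \<omega> i) * weight \<alpha> \<alpha>\<^sub>s \<beta> \<beta>\<^sub>s \<omega> =
        rate \<alpha> \<alpha>\<^sub>s \<beta> \<beta>\<^sub>s (move_at \<omega>' j) * weight \<alpha> \<alpha>\<^sub>s \<beta> \<beta>\<^sub>s \<omega>'"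
      unfolding w y z l h r using m pos by (auto simp: power_add field_simps)
    moreover have "1 \<le> j \<and> j < length \<omega>'" using right by (auto simp: length_refill)
    ultimately show ?thesis using m by simp
  next
    case (left_corner Q)
    thus ?thesis using move_at_left[of Q Zero mp] move_at_left[of Q Star Zero] pos unfolding w by simp
  next
    case (right_corner P)
    have "height P = 0" using ends(4) unfolding right_corner by simp
    thus ?thesis using right_corner move_at_right[of P pm Zero] move_at_right[of P Zero Star] pos
      unfolding w by (simp add: y_count_append z_count_append)
  qed
qed

section \<open>A configuration reachable from all others\<close>

fun charge :: "column \<Rightarrow> int" where
  "charge (Spins Plus b) = 1"
| "charge (Spins Minus b) = -1"
| "charge Zero = 0"
| "charge Star = 1"

fun moment :: "int \<Rightarrow> column list \<Rightarrow> int" where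
  "moment k [] = 0"
| "moment k (c # xs) = k * charge c + moment (k + 1) xs"

lemma moment_append: "moment k (xs @ ys) = moment k xs + moment (k + int (length xs)) ys"
  by (induction xs arbitrary: k) (simp_all add: add.assoc)

lemma moment_shift:
  assumes "\<forall>c\<in>set xs. charge c = e"
  shows "moment (k + 1) xs = moment k xs + e * int (length xs)"
  using assms
proof (induction xs arbitrary: k)
  case (Cons c xs)
  thus ?case using Cons.IH[of "k + 1"] by (simp add: algebra_simps)
qed simp

lemma moment_refill: "moment k (refill Q) = k + moment (k + 1) Q"
  by (cases Q rule: refill.cases) simp_all

text \<open>In the top row a move does no more than exchange two adjacent entries so that the larger one comes to
  the right, or change the first or the last two columns in a way that increases the moment.  The moves \<open>R1\<close> and \<open>R2\<close> are excluded, since they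
  introduce an entry -1.\<close>

lemma sweep_moment:
  assumes "sweep \<omega> i \<omega>' j" "move_at \<omega> i \<noteq> R1" "move_at \<omega> i \<noteq> R2"
  shows "moment 1 \<omega> < moment 1 \<omega>'"
  using assms(1)
proof cases
  case (left P M X y Q)
  have M: "\<forall>c\<in>set M. charge c = -1"
  proof
    fix c assume "c \<in> set M"
    thus "charge c = -1" using left(7) by (cases c rule: charge.cases) auto
  qed
  from left(8) show ?thesis
  proof cases
    case 1
    hence "0 \<le> charge y" by (elim not_top_minus_cases) auto
    thus ?thesis using left 1 moment_shift[OF M, of "1 + int (length P)"]
      by (simp add: moment_append algebra_simps)
  qed (use assms left move_at_right[of "P @ M" pm Star] move_at_right[of "P @ M" Zero Star] in auto)
next
  case (right U Q P X y)
  have U: "\<forall>c\<in>set U. charge c = 1"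
  proof
    fix c assume "c \<in> set U"
    thus "charge c = 1" using right(5) by (cases c rule: charge.cases) auto
  qed
  from right(8) show ?thesis
    by cases (use right moment_shift[OF U, of "2 + int (length P)"] in
      \<open>simp_all add: moment_append moment_refill algebra_simps\<close>)
next
  case (right_corner P)
  thus ?thesis by (simp add: moment_append)
qed simp

text \<open>All 0-columns come first, then columns \<open>pm\<close>; a first or last column that is not a 0-column is a
  \<open>*\<close>-column.\<close>

definition ground :: "nat \<Rightarrow> nat \<Rightarrow> column list" where
  "ground n n\<^sub>0 = map (\<lambda>j. if j \<le> n\<^sub>0 then Zero else if j = 1 \<or> j = n then Star else pm) [1..<n + 1]"

lemma length_ground [simp]: "length (ground n n\<^sub>0) = n"
  by (simp add: ground_def del: upt_Suc)

lemma nth_ground: "k < n \<Longrightarrow> ground n n\<^sub>0 ! k = (if k < n\<^sub>0 then Zero else if k = 0 \<or> k = n - 1 then Star else pm)"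
  by (auto simp: ground_def simp del: upt_Suc)

lemma ground_in_configs:
  assumes "2 \<le> n" "n\<^sub>0 \<le> n"
  shows "ground n n\<^sub>0 \<in> configs n n\<^sub>0"
proof -
  have ne: "ground n n\<^sub>0 \<noteq> []" using assms length_ground[of n n\<^sub>0] by (metis list.size(3) not_numeral_le_zero)
  have "height (take k (ground n n\<^sub>0)) = 0" for k
  proof -
    have "\<forall>c\<in>set xs. rise c = 0 \<Longrightarrow> height xs = 0" for xs by (induction xs) auto
    moreover have "\<forall>c\<in>set (ground n n\<^sub>0). rise c = 0" by (auto simp: ground_def)
    ultimately show ?thesis by (meson in_set_takeD)
  qed
  hence "dyck 0 (ground n n\<^sub>0)" by (simp add: dyck_iff)
  moreover have "Star \<notin> set (butlast (tl (ground n n\<^sub>0)))"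
    by (auto simp: in_set_conv_nth nth_butlast nth_tl nth_ground)
  moreover have "hd (ground n n\<^sub>0) \<in> {Zero, Star}" "last (ground n n\<^sub>0) \<in> {Zero, Star}"
    using assms ne by (auto simp: hd_conv_nth last_conv_nth nth_ground)
  moreover have "count_list (ground n n\<^sub>0) Zero = n\<^sub>0"
  proof -
    have "{j \<in> {1..length (ground n n\<^sub>0)}. col (ground n n\<^sub>0) j = Zero} = {1..n\<^sub>0}"
      using assms by (auto simp: col_def nth_ground split: if_splits)
    thus ?thesis using card_col_eq_count[of "ground n n\<^sub>0" Zero] by simp
  qed
  ultimately show ?thesis using assms ne by (simp add: configs_iff admissible_def)
qed

lemma height_admissible: "admissible \<omega> \<Longrightarrow> height \<omega> = 0"
  by (cases \<omega> rule: rev_cases) (auto simp: admissible_def)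

text \<open>The leftmost column with top entry -1 could move left or be turned into an entry 1 or a 0-column at the
  left boundary.  So all top entries are 1, and then balance makes all bottom entries -1.  A 0-column
  directly after a column \<open>pm\<close> or an initial \<open>*\<close>-column could move as well, so the 0-columns come first.\<close>

lemma stuck_is_ground:
  assumes adm: "admissible \<omega>" and n: "3 \<le> length \<omega>"
    and stuck: "\<And>i. 1 \<le> i \<Longrightarrow> i < length \<omega> \<Longrightarrow> move_at \<omega> i \<in> {No_move, R1, R2}"
  shows "\<omega> = ground (length \<omega>) (count_list \<omega> Zero)"
proof -
  let ?n = "length \<omega>"
  have ne: "\<omega> \<noteq> []" using n by auto
  have last_index: "Suc (?n - Suc 0) = ?n" using n by simp
  have ends: "hd \<omega> \<in> {Zero, Star}" "last \<omega> \<in> {Zero, Star}" "Star \<notin> set (butlast (tl \<omega>))" "dyck 0 \<omega>"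
    using adm by (auto simp: admissible_def)
  have c1: "col \<omega> 1 \<in> {Zero, Star}" and cn: "col \<omega> ?n \<in> {Zero, Star}"
    using ends ne by (auto simp: col_def hd_conv_nth last_conv_nth)
  have nostar: "col \<omega> j \<noteq> Star" if "2 \<le> j" "j \<le> ?n - 1" for j
  proof
    assume "col \<omega> j = Star"
    moreover have "butlast (tl \<omega>) ! (j - 2) = col \<omega> j" "j - 2 < length (butlast (tl \<omega>))"
      using that n by (auto simp: nth_butlast nth_tl col_def Suc_diff_Suc numeral_2_eq_2)
    ultimately show False using ends(3) by (metis nth_mem)
  qed
  have no_minus: "\<not> has_top Minus (col \<omega> j)" if "1 \<le> j" "j \<le> ?n" for j
    using that
  proof (induction j rule: less_induct)
    case (less j)
    show ?case
    proof
      assume minus: "has_top Minus (col \<omega> j)"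
      hence "j \<noteq> 1" "j \<noteq> ?n" using c1 cn by auto
      hence j: "2 \<le> j" "j \<le> ?n - 1" using less.prems by auto
      have prev: "\<not> has_top Minus (col \<omega> (j - 1))" using less j by simp
      \<comment> \<open>The height is 0 after a non-spin column and cannot drop below 0.\<close>
      have "col \<omega> j = mm \<Longrightarrow> is_spins (col \<omega> (j - 1))"
        using nonspin_height(2)[OF adm, of "j - 1"] take_height_nonneg[OF adm, of j]
          height_take_Suc[of j \<omega>] j by fastforce
      hence "move_at \<omega> (j - 1) \<notin> {No_move, R1, R2}"
        using minus prev c1 nostar[of "j - 1"] j
        by (cases "j = 2"; cases "col \<omega> j" rule: rise.cases; cases "col \<omega> (j - 1)" rule: rise.cases)
          (auto simp: move_at_def Let_def)
      moreover have "1 \<le> j - 1" "j - 1 < ?n" using j by linarith+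
      ultimately show False using stuck by blast
    qed
  qed
  have pm: "c = pm" if "c \<in> set \<omega>" "is_spins c" for c
  proof -
    have top: "\<not> has_top Minus c" if "c \<in> set \<omega>" for c
      using that no_minus[of "Suc k" for k] by (auto simp: in_set_conv_nth col_def Suc_le_eq)
    \<comment> \<open>With top entries 1 only, the path never descends; as it ends at height 0, it never rises.\<close>
    have "c \<noteq> pp"
    proof
      assume "c = pp"
      then obtain A B where \<omega>: "\<omega> = A @ pp # B" using \<open>c \<in> set \<omega>\<close> by (metis split_list)
      have "0 \<le> height xs" if "set xs \<subseteq> set \<omega>" for xs
        using that
      proof (induction xs)
        case (Cons c xs)
        thus ?case using top[of c] by (cases c rule: rise.cases) auto
      qed simp
      hence "0 \<le> height A" "0 \<le> height B" unfolding \<omega> by (simp_all add: subset_insertI2)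
      thus False using height_admissible[OF adm] unfolding \<omega> by simp
    qed
    thus ?thesis using top[OF that(1)] that(2) by (cases c rule: rise.cases) auto
  qed
  have col_cases: "col \<omega> j \<in> {Zero, Star, pm}" if "1 \<le> j" "j \<le> ?n" for j
    using pm[of "col \<omega> j"] that by (cases "col \<omega> j") (auto simp: col_def)
  have zeros_down: "col \<omega> j = Zero" if "1 \<le> j" "j < ?n" "col \<omega> (Suc j) = Zero" for j
  proof (rule ccontr)
    assume "col \<omega> j \<noteq> Zero"
    hence "j = 1 \<and> col \<omega> j = Star \<or> 2 \<le> j \<and> col \<omega> j = pm"
      using col_cases[of j] nostar[of j] c1 that by (cases "j = 1") auto
    hence "move_at \<omega> j \<notin> {No_move, R1, R2}"
      using that n last_index by (auto simp: move_at_def Let_def numeral_2_eq_2 Suc_diff_Suc)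
    thus False using stuck[of j] that by auto
  qed
  define Z where "Z = {j \<in> {1..?n}. col \<omega> j = Zero}"
  \<comment> \<open>The positions of the 0-columns form an initial segment, which is thus determined by their number.\<close>
  have "Z = {1..card Z}"
  proof (cases "Z = {}")
    case False
    have fin: "finite Z" by (simp add: Z_def)
    define m where "m = Max Z"
    have m: "m \<in> Z" unfolding m_def using fin False by simp
    have "j \<in> Z" if "1 \<le> j" "j \<le> m" for j
      using that(2,1)
    proof (induction rule: inc_induct)
      case base thus ?case using m by simp
    next
      case (step j)
      thus ?case using zeros_down[of j] by (auto simp: Z_def)
    qed
    moreover have "Z \<subseteq> {1..m}" using Max_ge[OF fin] by (auto simp: m_def Z_def)
    ultimately have "Z = {1..m}" by auto
    thus ?thesis by simp
  qed simp
  moreover have "card Z = count_list \<omega> Zero" unfolding Z_def by (rule card_col_eq_count)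
  ultimately have zero_iff: "col \<omega> j = Zero \<longleftrightarrow> j \<le> count_list \<omega> Zero" if "1 \<le> j" "j \<le> ?n" for j
    using that unfolding Z_def by (metis (mono_tags, lifting) atLeastAtMost_iff mem_Collect_eq)
  show ?thesis
  proof (rule nth_equalityI)
    fix k assume k: "k < ?n"
    have "\<omega> ! k = col \<omega> (Suc k)" by (simp add: col_def)
    moreover have "col \<omega> (Suc k) = Zero \<longleftrightarrow> k < count_list \<omega> Zero"
      using zero_iff[of "Suc k"] k by (simp add: Suc_le_eq)
    moreover have "col \<omega> (Suc k) \<noteq> Star" if "k \<noteq> 0" "k \<noteq> ?n - 1" using nostar[of "Suc k"] that k by simp
    moreover have "col \<omega> (Suc k) \<noteq> pm" if "k = 0 \<or> k = ?n - 1" using that c1 cn last_index by auto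
    ultimately show "\<omega> ! k = ground ?n (count_list \<omega> Zero) ! k"
      using col_cases[of "Suc k"] k by (auto simp: nth_ground)
  qed simp
qed

section \<open>The stationary distribution\<close>

lemma finite_configs: "finite (configs n n\<^sub>0)"
proof -
  have "finite (UNIV :: column set)"
  proof -
    have "c \<in> {pp, pm, mp, mm, Zero, Star}" for c by (cases c rule: rise.cases) auto
    hence "(UNIV :: column set) = {pp, pm, mp, mm, Zero, Star}" by blast
    thus ?thesis by (metis finite.emptyI finite_insert)
  qed
  from finite_lists_length_eq[OF this, of n] show ?thesis
    by (rule rev_finite_subset) (auto simp: configs_def)
qed

lemma T_star_No_move: "move_at \<omega> i = No_move \<Longrightarrow> T_star \<omega> i = \<omega>"
  by (simp add: T_star_def)

context
  fixes n n\<^sub>0 :: nat and \<alpha> \<alpha>\<^sub>s \<beta> \<beta>\<^sub>s :: real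
  assumes n: "3 \<le> n" "n\<^sub>0 \<le> n"
    and par: "0 < \<alpha>" "\<alpha> \<le> 1" "0 < \<alpha>\<^sub>s" "\<alpha>\<^sub>s \<le> 1" "0 < \<beta>" "\<beta> \<le> 1" "0 < \<beta>\<^sub>s" "\<beta>\<^sub>s \<le> 1"
begin

abbreviation (input) "states \<equiv> configs n n\<^sub>0"
abbreviation (input) "rt \<omega> i \<equiv> rate \<alpha> \<alpha>\<^sub>s \<beta> \<beta>\<^sub>s (move_at \<omega> i)"
abbreviation (input) "wt \<equiv> weight \<alpha> \<alpha>\<^sub>s \<beta> \<beta>\<^sub>s"
abbreviation (input) "step \<equiv> two_row_step \<alpha> \<alpha>\<^sub>s \<beta> \<beta>\<^sub>s"

definition active :: "(column list \<times> nat) set" where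
  "active = {(\<omega>, i). \<omega> \<in> states \<and> i \<in> {1..n - 1} \<and> move_at \<omega> i \<noteq> No_move}"

text \<open>The wall chosen is \<open>j\<^sub>1\<close>, \<open>j\<^sub>2\<close> or \<open>i\<close>, according to the kind of move; the choice operator saves the
  case distinction.\<close>

definition landing :: "column list \<times> nat \<Rightarrow> column list \<times> nat" where
  "landing = (\<lambda>(\<omega>, i). (T_star \<omega> i, SOME j. sweep \<omega> i (T_star \<omega> i) j))"

lemma states_iff: "\<omega> \<in> states \<longleftrightarrow> length \<omega> = n \<and> count_list \<omega> Zero = n\<^sub>0 \<and> admissible \<omega>"
  using configs_iff n by simp

lemma sweep_landing:
  assumes "(\<omega>, i) \<in> active"
  shows "sweep \<omega> i (T_star \<omega> i) (snd (landing (\<omega>, i)))"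
proof -
  have "\<omega> \<in> states" "1 \<le> i" "i < n" "move_at \<omega> i \<noteq> No_move" using assms n by (auto simp: active_def)
  then obtain \<omega>' j where "sweep \<omega> i \<omega>' j" using sweep_exists[of \<omega> i] n by (metis states_iff)
  hence "sweep \<omega> i (T_star \<omega> i) j" using T_star_sweep by blast
  thus ?thesis unfolding landing_def by (simp add: someI)
qed

lemma T_star_in_states:
  assumes "\<omega> \<in> states" "i \<in> {1..n - 1}"
  shows "T_star \<omega> i \<in> states"
proof (cases "move_at \<omega> i = No_move")
  case True
  thus ?thesis using assms T_star_No_move by simp
next
  case False
  hence "(\<omega>, i) \<in> active" using assms by (simp add: active_def)
  from sweep_configs[OF sweep_landing[OF this] assms(1)] show ?thesis using n by simp
qed

text \<open>An injective map of a finite set into itself is onto.\<close>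

lemma landing_bij: "bij_betw landing active active"
proof -
  have "finite active"
    by (rule finite_subset[of _ "states \<times> {1..n - 1}"]) (auto simp: active_def finite_configs)
  moreover have "landing x \<in> active" if "x \<in> active" for x
  proof -
    obtain \<omega> i where x: "x = (\<omega>, i)" by (cases x)
    have \<omega>: "\<omega> \<in> states" using that x by (simp add: active_def)
    note sw = sweep_landing[OF that[unfolded x]]
    have "T_star \<omega> i \<in> states" using sweep_configs[OF sw \<omega>] n by simp
    thus ?thesis
      using sweep_balance[OF sw _ par(1,3,5,7)] \<omega>
      by (auto simp: active_def x states_iff landing_def)
  qed
  moreover have "inj_on landing active"
  proof (rule inj_onI)
    fix x y assume "x \<in> active" "y \<in> active" and eq: "landing x = landing y"
    moreover obtain \<omega> i \<omega>' i' where "x = (\<omega>, i)" "y = (\<omega>', i')" by (cases x; cases y)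
    ultimately show "x = y"
      using sweep_landing[of \<omega> i] sweep_landing[of \<omega>' i'] sweep_inj
      by (metis (no_types, lifting) case_prod_conv fst_conv landing_def)
  qed
  ultimately show ?thesis
    unfolding bij_betw_def using endo_inj_surj[of active landing] by blast
qed

text \<open>The flow into \<open>\<omega>'\<close> and the flow out of it are sums over pairs of a configuration and a wall, and
  \<open>landing\<close> carries the terms of the first sum to those of the second.\<close>

lemma weight_invariant:
  assumes "\<omega>' \<in> states"
  shows "(\<Sum>\<omega>\<in>states. wt \<omega> * pmf (step \<omega>) \<omega>') = wt \<omega>'"
proof -
  let ?I = "{1..n - 1}"
  let ?f = "\<lambda>(\<omega>, i). rt \<omega> i * wt \<omega>"
  let ?in = "\<lambda>(\<omega>, i). rt \<omega> i * wt \<omega> * of_bool (T_star \<omega> i = \<omega>')"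
  let ?out = "\<lambda>(\<omega>, i). rt \<omega> i * wt \<omega> * of_bool (\<omega> = \<omega>')"
  have "(\<Sum>x\<in>active. ?in x) = (\<Sum>x\<in>active. ?out (landing x))"
  proof (rule sum.cong)
    fix x assume "x \<in> active"
    moreover obtain \<omega> i where x: "x = (\<omega>, i)" by (cases x)
    ultimately have sw: "sweep \<omega> i (T_star \<omega> i) (snd (landing (\<omega>, i)))" and "\<omega> \<in> states"
      using sweep_landing by (simp_all add: active_def)
    hence "?f x = ?f (landing x)"
      using sweep_balance[OF sw _ par(1,3,5,7)] by (simp add: x states_iff landing_def)
    thus "?in x = ?out (landing x)" by (simp add: x landing_def)
  qed simp
  also have "\<dots> = (\<Sum>x\<in>active. ?out x)" by (rule sum.reindex_bij_betw[OF landing_bij])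
  finally have "(\<Sum>x\<in>active. ?in x - ?out x) = 0" by (simp only: sum_subtractf diff_self)
  \<comment> \<open>Where no move is possible, the configuration flows into itself, so inflow and outflow cancel.\<close>
  moreover have "(\<Sum>x\<in>states \<times> ?I. ?in x - ?out x) = (\<Sum>x\<in>active. ?in x - ?out x)"
    by (rule sum.mono_neutral_right)
      (auto simp: active_def finite_configs T_star_No_move)
  ultimately have flow: "(\<Sum>\<omega>\<in>states. \<Sum>i\<in>?I. ?in (\<omega>, i) - ?out (\<omega>, i)) = 0"
    by (simp add: sum.cartesian_product)
  have "wt \<omega> * pmf (step \<omega>) \<omega>' =
      ((\<Sum>i\<in>?I. ?in (\<omega>, i) - ?out (\<omega>, i)) + real (n - 1) * (wt \<omega> * of_bool (\<omega> = \<omega>'))) / real (n - 1)"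
    if "\<omega> \<in> states" for \<omega>
  proof -
    have l: "length \<omega> = n" using that by (simp add: states_iff)
    have "wt \<omega> * (\<Sum>i\<in>?I. rt \<omega> i * of_bool (T_star \<omega> i = \<omega>') + (1 - rt \<omega> i) * of_bool (\<omega> = \<omega>'))
        = (\<Sum>i\<in>?I. (?in (\<omega>, i) - ?out (\<omega>, i)) + wt \<omega> * of_bool (\<omega> = \<omega>'))"
      unfolding sum_distrib_left by (rule sum.cong) (auto simp: algebra_simps)
    also have "\<dots> = (\<Sum>i\<in>?I. ?in (\<omega>, i) - ?out (\<omega>, i)) + real (n - 1) * (wt \<omega> * of_bool (\<omega> = \<omega>'))"
      by (simp add: sum.distrib)
    finally show ?thesis
      using pmf_two_row_step[OF _ par, of \<omega> \<omega>'] l n by simp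
  qed
  hence "(\<Sum>\<omega>\<in>states. wt \<omega> * pmf (step \<omega>) \<omega>') = (\<Sum>\<omega>\<in>states.
      ((\<Sum>i\<in>?I. ?in (\<omega>, i) - ?out (\<omega>, i)) + real (n - 1) * (wt \<omega> * of_bool (\<omega> = \<omega>'))) / real (n - 1))"
    by (rule sum.cong[OF refl])
  also have "\<dots> = ((\<Sum>\<omega>\<in>states. \<Sum>i\<in>?I. ?in (\<omega>, i) - ?out (\<omega>, i)) +
      real (n - 1) * (\<Sum>\<omega>\<in>states. wt \<omega> * of_bool (\<omega> = \<omega>'))) / real (n - 1)"
    unfolding sum_divide_distrib[symmetric] sum.distrib sum_distrib_left ..
  also have "(\<Sum>\<omega>\<in>states. wt \<omega> * of_bool (\<omega> = \<omega>')) = wt \<omega>'"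
    using assms finite_configs by (simp add: of_bool_def if_distrib cong: if_cong)
  finally show ?thesis unfolding flow using n by simp
qed

lemma step_T_star:
  assumes "\<omega> \<in> states" "i \<in> {1..n - 1}"
  shows "T_star \<omega> i \<in> set_pmf (step \<omega>)"
proof -
  have l: "length \<omega> = n" using assms by (simp add: states_iff)
  have "0 < rt \<omega> i" "rt \<omega> i \<le> 1" using par by (cases "move_at \<omega> i"; simp)+
  hence "True \<in> set_pmf (bernoulli_pmf (rt \<omega> i))" by (simp add: set_pmf_iff)
  moreover have "set_pmf (pmf_of_set {1..n - 1}) = {1..n - 1}" using n by simp
  ultimately show ?thesis using assms(2) unfolding two_row_step_def set_bind_pmf l set_return_pmf
    by (auto intro!: bexI[of _ i] bexI[of _ True])
qed

text \<open>A reachable configuration of maximal moment admits no move that increases the moment.\<close>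

lemma reaches_ground:
  assumes "\<omega> \<in> states"
  shows "(\<omega>, ground n n\<^sub>0) \<in> {(x, y). x \<in> states \<and> y \<in> states \<and> y \<in> set_pmf (step x)}\<^sup>*" (is "_ \<in> ?R\<^sup>*")
proof -
  define V where "V = {v. (\<omega>, v) \<in> ?R\<^sup>*}"
  have "V \<subseteq> states"
  proof
    fix v assume "v \<in> V"
    hence "(\<omega>, v) \<in> ?R\<^sup>*" by (simp add: V_def)
    thus "v \<in> states" by (cases rule: rtranclE) (use assms in auto)
  qed
  hence "finite V" by (rule finite_subset[OF _ finite_configs])
  have "\<omega> \<in> V" by (simp add: V_def)
  have "Max (moment 1 ` V) \<in> moment 1 ` V" using \<open>finite V\<close> \<open>\<omega> \<in> V\<close> by (intro Max_in) auto
  then obtain v where v: "v \<in> V" "\<And>u. u \<in> V \<Longrightarrow> moment 1 u \<le> moment 1 v"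
    using \<open>finite V\<close> by (metis (no_types, lifting) Max_ge finite_imageI imageE imageI)
  hence v_state: "v \<in> states" using \<open>V \<subseteq> states\<close> by blast
  have "move_at v i \<in> {No_move, R1, R2}" if i: "1 \<le> i" "i < length v" for i
  proof (rule ccontr)
    assume *: "move_at v i \<notin> {No_move, R1, R2}"
    have i_wall: "i \<in> {1..n - 1}" using i v_state by (simp add: states_iff)
    hence "(v, i) \<in> active" using * v_state by (simp add: active_def)
    hence "moment 1 v < moment 1 (T_star v i)"
      using sweep_moment[OF sweep_landing] * by simp
    moreover have "(v, T_star v i) \<in> ?R" using v_state T_star_in_states[OF v_state i_wall] step_T_star[OF v_state i_wall] by simp
    hence "T_star v i \<in> V" using v(1) unfolding V_def by (auto intro: rtrancl_into_rtrancl)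
    ultimately show False using v(2) by force
  qed
  hence "v = ground n n\<^sub>0" using stuck_is_ground[of v] v_state n by (simp add: states_iff)
  thus ?thesis using v(1) by (simp add: V_def)
qed

lemma weight_pos: "0 < wt \<omega>"
  using par by (simp add: weight_def)

definition normalized_weight :: "column list pmf" where
  "normalized_weight = embed_pmf (\<lambda>\<omega>. if \<omega> \<in> states then wt \<omega> / partition_function \<alpha> \<alpha>\<^sub>s \<beta> \<beta>\<^sub>s n n\<^sub>0 else 0)"

lemma partition_function_pos: "0 < partition_function \<alpha> \<alpha>\<^sub>s \<beta> \<beta>\<^sub>s n n\<^sub>0"
  unfolding partition_function_def
  using ground_in_configs[of n n\<^sub>0] n by (intro sum_pos finite_configs weight_pos) auto

lemma pmf_normalized_weight: "pmf normalized_weight \<omega> = (if \<omega> \<in> states then wt \<omega> / partition_function \<alpha> \<alpha>\<^sub>s \<beta> \<beta>\<^sub>s n n\<^sub>0 else 0)"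
proof -
  let ?Z = "partition_function \<alpha> \<alpha>\<^sub>s \<beta> \<beta>\<^sub>s n n\<^sub>0"
  let ?f = "\<lambda>\<omega>. if \<omega> \<in> states then wt \<omega> / ?Z else 0"
  have nn: "0 \<le> ?f \<omega>" for \<omega> using weight_pos[of \<omega>] partition_function_pos by simp
  have "(\<integral>\<^sup>+ \<omega>. ennreal (?f \<omega>) \<partial>count_space UNIV) = (\<Sum>\<omega>\<in>states. ennreal (?f \<omega>))"
    by (rule nn_integral_count_space'[OF finite_configs]) auto
  also have "\<dots> = ennreal (\<Sum>\<omega>\<in>states. ?f \<omega>)" using nn by (intro sum_ennreal) blast
  also have "(\<Sum>\<omega>\<in>states. ?f \<omega>) = 1"
    using partition_function_pos by (simp add: sum_divide_distrib[symmetric] partition_function_def)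
  finally show ?thesis unfolding normalized_weight_def by (intro pmf_embed_pmf nn) simp
qed

lemma normalized_weight_stationary: "stationary_distribution states step normalized_weight"
proof -
  let ?Z = "partition_function \<alpha> \<alpha>\<^sub>s \<beta> \<beta>\<^sub>s n n\<^sub>0"
  have sub: "set_pmf normalized_weight \<subseteq> states" by (auto simp: set_pmf_iff pmf_normalized_weight split: if_splits)
  have closed: "set_pmf (step \<omega>) \<subseteq> states" if "\<omega> \<in> states" for \<omega>
  proof -
    have "length \<omega> = n" "{1..n - 1} \<noteq> {}" using that n by (auto simp: states_iff)
    thus ?thesis using T_star_in_states[OF that] that
      unfolding two_row_step_def set_bind_pmf by (auto split: if_splits)
  qed
  have "bind_pmf normalized_weight step = normalized_weight"
  proof (rule pmf_eqI)
    fix \<omega>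
    show "pmf (bind_pmf normalized_weight step) \<omega> = pmf normalized_weight \<omega>"
    proof (cases "\<omega> \<in> states")
      case True
      have "pmf (bind_pmf normalized_weight step) \<omega> = (\<Sum>x\<in>states. wt x * pmf (step x) \<omega>) / ?Z"
        unfolding pmf_bind_finite[OF finite_configs sub] sum_divide_distrib
        by (rule sum.cong) (simp_all add: pmf_normalized_weight)
      thus ?thesis using True weight_invariant[OF True] by (simp add: pmf_normalized_weight)
    next
      case False
      hence "\<omega> \<notin> set_pmf (bind_pmf normalized_weight step)" using sub closed by auto
      hence "pmf (bind_pmf normalized_weight step) \<omega> = 0" unfolding set_pmf_iff by blast
      thus ?thesis using False by (simp add: pmf_normalized_weight)
    qed
  qed
  thus ?thesis using sub by (simp add: stationary_distribution_def)
qed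

lemma unique_stationary:
  "\<exists>\<pi>. (\<forall>p. stationary_distribution states step p \<longleftrightarrow> p = \<pi>) \<and>
    (\<forall>\<omega>\<in>states. pmf \<pi> \<omega> = wt \<omega> / partition_function \<alpha> \<alpha>\<^sub>s \<beta> \<beta>\<^sub>s n n\<^sub>0)"
proof (intro exI[of _ normalized_weight] conjI allI ballI iffI)
  fix p assume "stationary_distribution states step p"
  thus "p = normalized_weight"
    using stationary_distribution_unique[OF finite_configs _ reaches_ground _ normalized_weight_stationary]
      ground_in_configs[of n n\<^sub>0] n by simp
qed (use normalized_weight_stationary in \<open>simp_all add: pmf_normalized_weight\<close>)

end

theorem theorem6p4:
  fixes n n\<^sub>0 :: nat and \<alpha> \<alpha>\<^sub>s \<beta> \<beta>\<^sub>s :: real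
  assumes "n \<ge> 3" and "n\<^sub>0 \<le> n"
    and "0 < \<alpha>" "\<alpha> \<le> 1" and "0 < \<alpha>\<^sub>s" "\<alpha>\<^sub>s \<le> 1"
    and "0 < \<beta>" "\<beta> \<le> 1" and "0 < \<beta>\<^sub>s" "\<beta>\<^sub>s \<le> 1"
  shows "\<exists>\<pi>. (\<forall>p. stationary_distribution (configs n n\<^sub>0) (two_row_step \<alpha> \<alpha>\<^sub>s \<beta> \<beta>\<^sub>s) p \<longleftrightarrow> p = \<pi>) \<and>
    (\<forall>\<omega>\<in>configs n n\<^sub>0. pmf \<pi> \<omega> = weight \<alpha> \<alpha>\<^sub>s \<beta> \<beta>\<^sub>s \<omega> / partition_function \<alpha> \<alpha>\<^sub>s \<beta> \<beta>\<^sub>s n n\<^sub>0)"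
  using assms by (rule unique_stationary)

end
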